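(* Let $R$ be a separative exchange ring in which $2$ is invertible, and let $a\in R$ be such that $a-a^3$ is regular. Suppose (1) the right $R$-modules $aR/ar(a^2)$ and $R/\big(aR+r(a)\big)$ are projective, and (2) $Rar(a^2)=\ell(a^2)aR=R(a-a^3)R$. Then $a$ is special clean, i.e., there exists an idempotent $e\in R$ such that $a-e$ is a unit of $R$ and $aR\cap eR=0$.
   Context: All rings are associative with identity; modules are right modules. An element $x\in R$ is regular if $x=xyx$ for some $y\in R$. $R$ is an exchange ring if for every $x\in R$ there is an idempotent $e\in xR$ with $1-e\in(1-x)R$. $R$ is separative if for all finitely generated projective right $R$-modules $A,B$: $A\oplus A\cong A\oplus B\cong B\oplus B$ implies $A\cong B$. For $x\in R$, $r(x)=\{y\in R: xy=0\}$ and $\ell(x)=\{y\in R: yx=0\}$. $ar(a^2)=\{ay: y\in r(a^2)\}$; $Rar(a^2)$ and $\ell(a^2)aR$ denote the two-sided ideals generated by $ar(a^2)$ and $\ell(a^2)a$ respectively, and $R(a-a^3)R$ the two-sided ideal generated by $a-a^3$. *)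

theory Defs
  imports Main
begin

definition is_unit :: "'a::ring_1 \<Rightarrow> bool" where
  "is_unit x \<longleftrightarrow> (\<exists>y. x * y = 1 \<and> y * x = 1)"

definition regular :: "'a::ring_1 \<Rightarrow> bool" where
  "regular x \<longleftrightarrow> (\<exists>y. x = x * y * x)"

definition exchange_ring :: "'a::ring_1 itself \<Rightarrow> bool" where
  "exchange_ring (t::'a itself) \<longleftrightarrow>
     (\<forall>x::'a. \<exists>e. e * e = e \<and> (\<exists>r. e = x * r) \<and> (\<exists>s. 1 - e = (1 - x) * s))"

definition rprinc :: "'a::ring_1 \<Rightarrow> 'a set" where
  "rprinc x = {x * y | y. True}"

definition rann :: "'a::ring_1 \<Rightarrow> 'a set" where
  "rann x = {y. x * y = 0}"

definition lann :: "'a::ring_1 \<Rightarrow> 'a set" where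
  "lann x = {y. y * x = 0}"

definition set_plus :: "'a::ring_1 set \<Rightarrow> 'a set \<Rightarrow> 'a set" where
  "set_plus A B = {x + y | x y. x \<in> A \<and> y \<in> B}"

definition ideal_gen :: "'a::ring_1 set \<Rightarrow> 'a set" where
  "ideal_gen S = {(\<Sum>i<n. x i * s i * y i) | (n::nat) x s y. \<forall>i<n. s i \<in> S}"

record ('a, 'm) rmod =
  mcarrier :: "'m set"
  madd :: "'m \<Rightarrow> 'm \<Rightarrow> 'm"
  mzero :: 'm
  smul :: "'m \<Rightarrow> 'a \<Rightarrow> 'm"

definition rmodule :: "('a::ring_1, 'm) rmod \<Rightarrow> bool" where
  "rmodule M \<longleftrightarrow>
    (let C = mcarrier M; p = madd M; z = mzero M; s = smul M in
      z \<in> C \<and>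
      (\<forall>x\<in>C. \<forall>y\<in>C. p x y \<in> C) \<and>
      (\<forall>x\<in>C. \<forall>y\<in>C. \<forall>w\<in>C. p (p x y) w = p x (p y w)) \<and>
      (\<forall>x\<in>C. \<forall>y\<in>C. p x y = p y x) \<and>
      (\<forall>x\<in>C. p z x = x) \<and>
      (\<forall>x\<in>C. \<exists>y\<in>C. p x y = z) \<and>
      (\<forall>x\<in>C. \<forall>r. s x r \<in> C) \<and>
      (\<forall>x\<in>C. \<forall>y\<in>C. \<forall>r. s (p x y) r = p (s x r) (s y r)) \<and>
      (\<forall>x\<in>C. \<forall>r t. s x (r + t) = p (s x r) (s x t)) \<and>
      (\<forall>x\<in>C. \<forall>r t. s (s x r) t = s x (r * t)) \<and>
      (\<forall>x\<in>C. s x 1 = x))"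

definition mhom :: "('a::ring_1, 'm) rmod \<Rightarrow> ('a, 'n) rmod \<Rightarrow> ('m \<Rightarrow> 'n) \<Rightarrow> bool" where
  "mhom M N f \<longleftrightarrow>
    (\<forall>x\<in>mcarrier M. f x \<in> mcarrier N) \<and>
    (\<forall>x\<in>mcarrier M. \<forall>y\<in>mcarrier M. f (madd M x y) = madd N (f x) (f y)) \<and>
    (\<forall>x\<in>mcarrier M. \<forall>r. f (smul M x r) = smul N (f x) r)"

definition miso :: "('a::ring_1, 'm) rmod \<Rightarrow> ('a, 'n) rmod \<Rightarrow> bool" where
  "miso M N \<longleftrightarrow> (\<exists>f. mhom M N f \<and> bij_betw f (mcarrier M) (mcarrier N))"

definition dsum :: "('a, 'm) rmod \<Rightarrow> ('a, 'n) rmod \<Rightarrow> ('a, 'm \<times> 'n) rmod" where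
  "dsum M N = \<lparr> mcarrier = mcarrier M \<times> mcarrier N,
     madd = (\<lambda>(x, y) (x', y'). (madd M x x', madd N y y')),
     mzero = (mzero M, mzero N),
     smul = (\<lambda>(x, y) r. (smul M x r, smul N y r)) \<rparr>"

definition fin_gen :: "('a::ring_1, 'm) rmod \<Rightarrow> bool" where
  "fin_gen M \<longleftrightarrow> (\<exists>xs. set xs \<subseteq> mcarrier M \<and>
     (\<forall>m\<in>mcarrier M. \<exists>rs. length rs = length xs \<and>
        m = foldr (madd M) (map2 (smul M) xs rs) (mzero M)))"

text \<open>Projective: lifting property along surjective homomorphisms.  The test modules
  B and C range over modules with carriers in the types ('m => 'a) and 'm; this
  is equivalent to full projectivity, since the free module on the carrier of M
  (finitely supported functions 'm => 'a) and M itself are among them, and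
  the splitting of the canonical epimorphism from that free module already
  implies projectivity.\<close>
definition projective :: "('a::ring_1, 'm) rmod \<Rightarrow> bool" where
  "projective M \<longleftrightarrow> rmodule M \<and>
    (\<forall>(B :: ('a, 'm \<Rightarrow> 'a) rmod) (C :: ('a, 'm) rmod) g f.
       rmodule B \<and> rmodule C \<and> mhom B C g \<and> g ` mcarrier B = mcarrier C \<and> mhom M C f
       \<longrightarrow> (\<exists>h. mhom M B h \<and> (\<forall>x\<in>mcarrier M. g (h x) = f x)))"

definition quot_mod :: "'a::ring_1 set \<Rightarrow> 'a set \<Rightarrow> ('a, 'a set) rmod" where
  "quot_mod N K = \<lparr> mcarrier = {{x + k | k. k \<in> K} | x. x \<in> N},
     madd = (\<lambda>X Y. {z. \<exists>x\<in>X. \<exists>y\<in>Y. z - (x + y) \<in> K}),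
     mzero = K,
     smul = (\<lambda>X r. {z. \<exists>x\<in>X. z - x * r \<in> K}) \<rparr>"

text \<open>Separative: every finitely generated projective right R-module is isomorphic to
  a module whose carrier lies in nat => 'a (a submodule of some R^n), so it suffices
  (and is equivalent) to quantify over modules with carriers of that type.\<close>
definition separative :: "'a::ring_1 itself \<Rightarrow> bool" where
  "separative (t::'a itself) \<longleftrightarrow>
    (\<forall>(A :: ('a, nat \<Rightarrow> 'a) rmod) (B :: ('a, nat \<Rightarrow> 'a) rmod).
       fin_gen A \<and> projective A \<and> fin_gen B \<and> projective B \<and>
       miso (dsum A A) (dsum A B) \<and> miso (dsum A B) (dsum B B) \<longrightarrow> miso A B)"

end

theory Submission
  imports Defs
begin

text \<open>
  Put d = a - a^3 and W = dR, a projective right ideal stable under left multiplication by a. The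
  kernel of a on W is P = aR \<inter> r(a), and the cokernel of a on W is isomorphic to
  R / (aR + r(a)), that is to a complement Q of aR + r(a). Hence P \<oplus> aW and Q \<oplus> aW are both isomorphic
  to W. The ideal hypothesis makes W a direct summand of some P^n and of some Q^m, so separativity
  cancels aW and gives an isomorphism \<phi> from P to Q.

  Write r(a) = P \<oplus> K' and aR = P \<oplus> I', so that R = P \<oplus> K' \<oplus> I' \<oplus> Q. The projection e onto
  K' \<oplus> Q along I' \<oplus> {x + \<phi>(x) | x \<in> P} works: its image is a complement of aR, which gives
  surjectivity of a - e, and its kernel is a complement of r(a), which gives injectivity.
\<close>

section \<open>Finitely generated projective modules\<close>

text \<open>What makes d useful is that 1 - a^2 is congruent to 1 modulo a. If a^2 z = 0 then d z =
  a z, which puts aR \<inter> r(a) inside W. If d z = 0 then a (z - a^2 z) = 0, so z = a^2 z + (z -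
  a^2 z) lies in aR + r(a); hence z \<mapsto> d z induces an isomorphism from R/(aR + r(a)) onto
  W/aW. As this quotient is projective, aW is a summand of W, and then the map a from W onto aW
  splits too.

  The isomorphism \<phi> is what the last construction needs. The projection onto K' \<oplus> Q
  along I' \<oplus> P has a suitable image, but its kernel meets r(a) in P. Tilting P to the graph
  of \<phi> makes the intersection zero because \<phi> is injective, and the new kernel still spans
  R together with r(a) because \<phi> is onto.

  Separativity is stated for carriers in \<open>nat \<Rightarrow> 'a\<close>, whereas P, Q and W are
  right ideals. All of them are therefore compared in the monoid of isomorphism classes; the result
  is turned back into ring elements u, v with u v and v u idempotents generating Q and P.\<close>

lemma rmodule_rules [simp]:
  assumes "rmodule M"
  shows "mzero M \<in> mcarrier M"
    and "x \<in> mcarrier M \<Longrightarrow> y \<in> mcarrier M \<Longrightarrow> madd M x y \<in> mcarrier M"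
    and "x \<in> mcarrier M \<Longrightarrow> smul M x r \<in> mcarrier M"
    and "x \<in> mcarrier M \<Longrightarrow> smul M x 1 = x"
    and "x \<in> mcarrier M \<Longrightarrow> smul M (smul M x r) s = smul M x (r * s)"
  using assms by (simp_all add: rmodule_def Let_def)

lemma rmodule_zero_left [simp]:
  assumes "rmodule M" and "x \<in> mcarrier M"
  shows "madd M (mzero M) x = x"
proof -
  have *: "\<forall>x\<in>mcarrier M. madd M (mzero M) x = x"
    using assms(1) unfolding rmodule_def Let_def by (elim conjE)
  show ?thesis using *[rule_format, OF assms(2)] .
qed

lemma rmodule_distrib:
  assumes "rmodule M" and "x \<in> mcarrier M"
  shows "y \<in> mcarrier M \<Longrightarrow> smul M (madd M x y) r = madd M (smul M x r) (smul M y r)"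
    and "smul M x (r + s) = madd M (smul M x r) (smul M x s)"
proof -
  have *: "\<forall>x\<in>mcarrier M. \<forall>y\<in>mcarrier M. \<forall>r. smul M (madd M x y) r = madd M (smul M x r) (smul M y r)"
    and **: "\<forall>x\<in>mcarrier M. \<forall>r s. smul M x (r + s) = madd M (smul M x r) (smul M x s)"
    using assms(1) unfolding rmodule_def Let_def by - (elim conjE, assumption)+
  show "y \<in> mcarrier M \<Longrightarrow> smul M (madd M x y) r = madd M (smul M x r) (smul M y r)"
    using * assms(2) by blast
  show "smul M x (r + s) = madd M (smul M x r) (smul M x s)"
    using ** assms(2) by blast
qed

lemma rmodule_inverse:
  assumes "rmodule M" and "x \<in> mcarrier M"
  obtains y where "y \<in> mcarrier M" and "madd M x y = mzero M"
proof -
  have *: "\<forall>x\<in>mcarrier M. \<exists>y\<in>mcarrier M. madd M x y = mzero M"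
    using assms(1) unfolding rmodule_def Let_def by (elim conjE)
  show thesis using bspec[OF * assms(2)] that by blast
qed

lemma rmodule_commute:
  assumes "rmodule M" and "x \<in> mcarrier M" and "y \<in> mcarrier M"
  shows "madd M x y = madd M y x"
proof -
  have *: "\<forall>x\<in>mcarrier M. \<forall>y\<in>mcarrier M. madd M x y = madd M y x"
    using assms(1) unfolding rmodule_def Let_def by (elim conjE)
  show ?thesis using *[rule_format, OF assms(2,3)] .
qed

lemma rmodule_assoc:
  assumes "rmodule M" and "x \<in> mcarrier M" and "y \<in> mcarrier M" and "z \<in> mcarrier M"
  shows "madd M (madd M x y) z = madd M x (madd M y z)"
proof -
  have *: "\<forall>x\<in>mcarrier M. \<forall>y\<in>mcarrier M. \<forall>w\<in>mcarrier M.
      madd M (madd M x y) w = madd M x (madd M y w)"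
    using assms(1) unfolding rmodule_def Let_def by (elim conjE)
  show ?thesis using *[rule_format, OF assms(2-4)] .
qed

lemma rmodule_left_commute:
  assumes "rmodule M" and "x \<in> mcarrier M" and "y \<in> mcarrier M" and "z \<in> mcarrier M"
  shows "madd M x (madd M y z) = madd M y (madd M x z)"
  using rmodule_assoc[OF assms] rmodule_assoc[OF assms(1,3,2,4)] rmodule_commute[OF assms(1-3)]
  by argo

lemmas rmodule_ac = rmodule_assoc rmodule_commute rmodule_left_commute

lemma rmodule_zero_right [simp]:
  assumes "rmodule M" and "x \<in> mcarrier M"
  shows "madd M x (mzero M) = x"
  using assms by (simp add: rmodule_commute[of M x])

lemma rmodule_smul_zero [simp]:
  assumes "rmodule M" and x: "x \<in> mcarrier M"
  shows "smul M x 0 = mzero M"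
proof -
  let ?z = "smul M x 0"
  have z: "?z \<in> mcarrier M" using assms by simp
  then obtain y where y: "y \<in> mcarrier M" "madd M ?z y = mzero M"
    using rmodule_inverse[OF assms(1)] by blast
  have "madd M ?z ?z = ?z" using rmodule_distrib(2)[OF assms, of 0 0] by simp
  then have "madd M ?z (madd M ?z y) = madd M ?z y"
    using rmodule_assoc[OF assms(1) z z y(1)] by simp
  then show ?thesis using assms(1) z y by simp
qed

lemma rmodule_neg [simp]:
  assumes "rmodule M" and x: "x \<in> mcarrier M"
  shows "madd M x (smul M x (- 1)) = mzero M"
  using rmodule_distrib(2)[OF assms, of 1 "- 1"] assms by simp

lemma rmodule_zero_smul [simp]:
  assumes "rmodule M"
  shows "smul M (mzero M) r = mzero M"
  using rmodule_rules(5)[OF assms rmodule_rules(1)[OF assms], of 0 r] assms by simp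

text \<open>The existential inverse axiom is replaced by the concrete inverse
  \<open>smul M x (- 1)\<close>, so that later module checks are purely equational.\<close>

lemma rmoduleI:
  assumes "mzero M \<in> mcarrier M"
    and "\<And>x y. x \<in> mcarrier M \<Longrightarrow> y \<in> mcarrier M \<Longrightarrow> madd M x y \<in> mcarrier M"
    and "\<And>x r. x \<in> mcarrier M \<Longrightarrow> smul M x r \<in> mcarrier M"
    and "\<And>x y z. x \<in> mcarrier M \<Longrightarrow> y \<in> mcarrier M \<Longrightarrow> z \<in> mcarrier M \<Longrightarrow>
      madd M (madd M x y) z = madd M x (madd M y z)"
    and "\<And>x y. x \<in> mcarrier M \<Longrightarrow> y \<in> mcarrier M \<Longrightarrow> madd M x y = madd M y x"
    and "\<And>x. x \<in> mcarrier M \<Longrightarrow> madd M (mzero M) x = x"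
    and "\<And>x. x \<in> mcarrier M \<Longrightarrow> madd M x (smul M x (- 1)) = mzero M"
    and "\<And>x y r. x \<in> mcarrier M \<Longrightarrow> y \<in> mcarrier M \<Longrightarrow>
      smul M (madd M x y) r = madd M (smul M x r) (smul M y r)"
    and "\<And>x r s. x \<in> mcarrier M \<Longrightarrow> smul M x (r + s) = madd M (smul M x r) (smul M x s)"
    and "\<And>x r s. x \<in> mcarrier M \<Longrightarrow> smul M (smul M x r) s = smul M x (r * s)"
    and "\<And>x. x \<in> mcarrier M \<Longrightarrow> smul M x 1 = x"
  shows "rmodule M"
proof -
  have inv: "\<exists>y\<in>mcarrier M. madd M x y = mzero M" if "x \<in> mcarrier M" for x
    using assms(3,7) that by blast
  show ?thesis
    unfolding rmodule_def Let_def
    by (intro conjI ballI allI; rule assms(1-6,8-11) inv; assumption)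
qed

lemma rmodule_submodule:
  assumes "rmodule M" and "S \<subseteq> mcarrier M" and "mzero M \<in> S"
    and "\<And>x y. x \<in> S \<Longrightarrow> y \<in> S \<Longrightarrow> madd M x y \<in> S"
    and "\<And>x r. x \<in> S \<Longrightarrow> smul M x r \<in> S"
  shows "rmodule (M\<lparr>mcarrier := S\<rparr>)"
proof -
  have C: "x \<in> mcarrier M" if "x \<in> S" for x using that assms(2) by blast
  show ?thesis
    by (rule rmoduleI)
      (use assms(1,3-5) C in \<open>simp_all add: rmodule_assoc rmodule_distrib rmodule_commute[OF assms(1) C C]\<close>)
qed

section \<open>Homomorphisms and isomorphisms of modules\<close>

lemma mhom_rules:
  assumes "mhom M N f"
  shows "x \<in> mcarrier M \<Longrightarrow> f x \<in> mcarrier N"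
    and "x \<in> mcarrier M \<Longrightarrow> y \<in> mcarrier M \<Longrightarrow> f (madd M x y) = madd N (f x) (f y)"
    and "x \<in> mcarrier M \<Longrightarrow> f (smul M x r) = smul N (f x) r"
  using assms by (simp_all add: mhom_def)

lemma mhom_zero:
  assumes "rmodule M" and "rmodule N" and f: "mhom M N f"
  shows "f (mzero M) = mzero N"
  using mhom_rules(3)[OF f, of "mzero M" 0] mhom_rules(1)[OF f, of "mzero M"] assms(1,2) by simp

lemma mhom_comp:
  "mhom M N f \<Longrightarrow> mhom N L g \<Longrightarrow> mhom M L (g \<circ> f)"
  by (simp add: mhom_def)

lemma misoI:
  assumes "mhom M N f" and "\<And>y. y \<in> mcarrier N \<Longrightarrow> g y \<in> mcarrier M"
    and "\<And>x. x \<in> mcarrier M \<Longrightarrow> g (f x) = x" and "\<And>y. y \<in> mcarrier N \<Longrightarrow> f (g y) = y"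
  shows "miso M N"
  unfolding miso_def
  using assms by (intro exI[of _ f] conjI bij_betw_byWitness[where f' = g]) (auto simp: mhom_def)

lemma misoE:
  assumes "miso M N" and M: "rmodule M"
  obtains f g where "mhom M N f" and "mhom N M g"
    and "\<And>x. x \<in> mcarrier M \<Longrightarrow> g (f x) = x" and "\<And>y. y \<in> mcarrier N \<Longrightarrow> f (g y) = y"
proof -
  obtain f where f: "mhom M N f" "bij_betw f (mcarrier M) (mcarrier N)"
    using assms(1) unfolding miso_def by blast
  define g where "g = inv_into (mcarrier M) f"
  have gf: "g (f x) = x" if "x \<in> mcarrier M" for x
    using f(2) that by (simp add: g_def bij_betw_inv_into_left)
  have fg: "f (g y) = y" if "y \<in> mcarrier N" for y
    using f(2) that by (simp add: g_def bij_betw_inv_into_right)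
  have gC: "g y \<in> mcarrier M" if "y \<in> mcarrier N" for y
    using f(2) that by (metis g_def bij_betw_imp_surj_on inv_into_into)
  have "g (madd N x y) = madd M (g x) (g y)" if "x \<in> mcarrier N" "y \<in> mcarrier N" for x y
    using gf[of "madd M (g x) (g y)"] mhom_rules(2)[OF f(1), of "g x" "g y"] that gC fg M by simp
  moreover have "g (smul N x r) = smul M (g x) r" if "x \<in> mcarrier N" for x r
    using gf[of "smul M (g x) r"] mhom_rules(3)[OF f(1), of "g x" r] that gC fg M by simp
  ultimately have "mhom N M g" using gC by (simp add: mhom_def)
  then show thesis by (rule that[OF f(1) _ gf fg])
qed

lemma miso_refl: "miso M M"
  by (rule misoI[where f = id and g = id]) (simp_all add: mhom_def)

lemma miso_sym:
  assumes "miso M N" and "rmodule M"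
  shows "miso N M"
proof -
  obtain f g where "mhom M N f" and g: "mhom N M g"
    and "\<And>x. x \<in> mcarrier M \<Longrightarrow> g (f x) = x" and "\<And>y. y \<in> mcarrier N \<Longrightarrow> f (g y) = y"
    using misoE[OF assms] by blast
  then show ?thesis
    by (intro misoI[OF g, of f]) (simp_all add: mhom_rules)
qed

lemma miso_trans:
  assumes "miso M N" and "miso N L"
  shows "miso M L"
  using assms unfolding miso_def by (meson mhom_comp bij_betw_trans)

section \<open>Binary direct sums\<close>

lemma dsum_sel [simp]:
  "mcarrier (dsum M N) = mcarrier M \<times> mcarrier N"
  "madd (dsum M N) (x, y) (x', y') = (madd M x x', madd N y y')"
  "mzero (dsum M N) = (mzero M, mzero N)"
  "smul (dsum M N) (x, y) r = (smul M x r, smul N y r)"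
  by (simp_all add: dsum_def)

lemma rmodule_dsum [simp]:
  assumes M: "rmodule M" and N: "rmodule N"
  shows "rmodule (dsum M N)"
proof (rule rmoduleI)
  show "madd (dsum M N) x y = madd (dsum M N) y x"
    if "x \<in> mcarrier (dsum M N)" and "y \<in> mcarrier (dsum M N)" for x y
    using that by (cases x; cases y) (simp add: rmodule_commute[OF M] rmodule_commute[OF N])
qed (use M N in \<open>auto simp: rmodule_assoc rmodule_distrib\<close>)

lemma dsum_commute: "miso (dsum M N) (dsum N M)"
  by (rule misoI[where f = prod.swap and g = prod.swap]) (auto simp: mhom_def)

lemma dsum_assoc: "miso (dsum (dsum M N) L) (dsum M (dsum N L))"
  by (rule misoI[where f = "\<lambda>((x, y), z). (x, (y, z))" and g = "\<lambda>(x, (y, z)). ((x, y), z)"])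
    (auto simp: mhom_def)

lemma dsum_cong:
  assumes "miso M M'" and "miso N N'" and "rmodule M" and "rmodule N"
  shows "miso (dsum M N) (dsum M' N')"
proof -
  obtain f f' where f: "mhom M M' f" "mhom M' M f'"
    "\<And>x. x \<in> mcarrier M \<Longrightarrow> f' (f x) = x" "\<And>y. y \<in> mcarrier M' \<Longrightarrow> f (f' y) = y"
    using misoE[OF assms(1,3)] by blast
  obtain g g' where g: "mhom N N' g" "mhom N' N g'"
    "\<And>x. x \<in> mcarrier N \<Longrightarrow> g' (g x) = x" "\<And>y. y \<in> mcarrier N' \<Longrightarrow> g (g' y) = y"
    using misoE[OF assms(2,4)] by blast
  show ?thesis
    by (rule misoI[where f = "map_prod f g" and g = "map_prod f' g'"])
      (use f g in \<open>auto simp: mhom_def\<close>)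
qed

text \<open>Dual bases characterise finitely generated projective modules without reference to
  test modules, hence uniformly in the carrier type.\<close>

definition lincomb :: "('a::ring_1, 'm) rmod \<Rightarrow> 'm list \<Rightarrow> 'a list \<Rightarrow> 'm" where
  "lincomb M xs rs = foldr (madd M) (map2 (smul M) xs rs) (mzero M)"

definition linear_form :: "('a::ring_1, 'm) rmod \<Rightarrow> ('m \<Rightarrow> 'a) \<Rightarrow> bool" where
  "linear_form M \<phi> \<longleftrightarrow>
    (\<forall>x\<in>mcarrier M. \<forall>y\<in>mcarrier M. \<phi> (madd M x y) = \<phi> x + \<phi> y) \<and>
    (\<forall>x\<in>mcarrier M. \<forall>r. \<phi> (smul M x r) = \<phi> x * r)"

definition dual_basis :: "('a::ring_1, 'm) rmod \<Rightarrow> 'm list \<Rightarrow> ('m \<Rightarrow> 'a) list \<Rightarrow> bool" where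
  "dual_basis M xs \<phi>s \<longleftrightarrow> set xs \<subseteq> mcarrier M \<and> length \<phi>s = length xs \<and>
    (\<forall>\<phi>\<in>set \<phi>s. linear_form M \<phi>) \<and>
    (\<forall>m\<in>mcarrier M. lincomb M xs (map (\<lambda>\<phi>. \<phi> m) \<phi>s) = m)"

definition fgp :: "('a::ring_1, 'm) rmod \<Rightarrow> bool" where
  "fgp M \<longleftrightarrow> rmodule M \<and> (\<exists>xs \<phi>s. dual_basis M xs \<phi>s)"

lemma fgp_rmodule: "fgp M \<Longrightarrow> rmodule M"
  by (simp add: fgp_def)

lemma lincomb_simps [simp]:
  "lincomb M [] rs = mzero M"
  "lincomb M (x # xs) (r # rs) = madd M (smul M x r) (lincomb M xs rs)"
  by (simp_all add: lincomb_def)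

lemma lincomb_closed [simp]:
  assumes "rmodule M" and "set xs \<subseteq> mcarrier M" and "length rs = length xs"
  shows "lincomb M xs rs \<in> mcarrier M"
  using assms(3,2) by (induction rs xs rule: list_induct2) (simp_all add: assms(1))

lemma mhom_lincomb:
  assumes "rmodule M" and "rmodule N" and f: "mhom M N f"
    and "set xs \<subseteq> mcarrier M" and "length rs = length xs"
  shows "f (lincomb M xs rs) = lincomb N (map f xs) rs"
  using assms(5,4)
  by (induction rs xs rule: list_induct2) (simp_all add: assms mhom_zero mhom_rules[OF f])

text \<open>The vectors need not be part of a dual basis: the forms alone carry the linearity. This
  freedom is what lets arbitrary preimages of basis vectors define a linear lift.\<close>

lemma mhom_lincomb_forms:
  assumes "length \<phi>s = length xs" and "rmodule N"
    and "set xs \<subseteq> mcarrier N" and "\<forall>\<phi>\<in>set \<phi>s. linear_form M \<phi>"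
  shows "mhom M N (\<lambda>m. lincomb N xs (map (\<lambda>\<phi>. \<phi> m) \<phi>s))"
  using assms(1,3,4)
proof (induction \<phi>s xs rule: list_induct2)
  case Nil
  then show ?case using assms(2) by (simp add: mhom_def)
next
  case (Cons \<phi> \<phi>s x xs)
  let ?h = "\<lambda>m. lincomb N xs (map (\<lambda>\<phi>. \<phi> m) \<phi>s)"
  have h: "mhom M N ?h" using Cons by simp
  have \<phi>: "linear_form M \<phi>" and x: "x \<in> mcarrier N" using Cons.prems by simp_all
  show ?case
    unfolding mhom_def
    using assms(2) x \<phi> mhom_rules[OF h]
    by (simp add: linear_form_def rmodule_distrib rmodule_ac)
qed

lemma fgp_fin_gen:
  assumes "fgp M"
  shows "fin_gen M"
proof -
  obtain xs \<phi>s where b: "dual_basis M xs \<phi>s" using assms fgp_def by blast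
  have "\<exists>rs. length rs = length xs \<and> m = lincomb M xs rs" if "m \<in> mcarrier M" for m
    using b that unfolding dual_basis_def
    by (intro exI[of _ "map (\<lambda>\<phi>. \<phi> m) \<phi>s"]) simp
  moreover have "set xs \<subseteq> mcarrier M" using b by (simp add: dual_basis_def)
  ultimately show ?thesis unfolding fin_gen_def lincomb_def by blast
qed

lemma fgp_projective:
  fixes M :: "('a::ring_1, 'm) rmod"
  assumes "fgp M"
  shows "projective M"
  unfolding projective_def
proof (intro conjI allI impI; (elim conjE)?)
  show M: "rmodule M" using assms fgp_rmodule by blast
  obtain xs \<phi>s where b: "dual_basis M xs \<phi>s" using assms fgp_def by blast
  fix B :: "('a, 'm \<Rightarrow> 'a) rmod" and C :: "('a, 'm) rmod" and g f
  assume B: "rmodule B" and C: "rmodule C" and g: "mhom B C g"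
    and sur: "g ` mcarrier B = mcarrier C" and f: "mhom M C f"
  \<comment> \<open>\<open>lft\<close> is not expected to be linear; it only selects preimages for
    the finitely many basis vectors.\<close>
  define lft where "lft x = (SOME y. y \<in> mcarrier B \<and> g y = f x)" for x
  have lft: "lft x \<in> mcarrier B \<and> g (lft x) = f x" if "x \<in> mcarrier M" for x
  proof -
    have "\<exists>y. y \<in> mcarrier B \<and> g y = f x" using sur mhom_rules(1)[OF f that] by (metis imageE)
    then show ?thesis unfolding lft_def by (rule someI_ex)
  qed
  have xs: "set xs \<subseteq> mcarrier M" and len: "length \<phi>s = length xs"
    and lin: "\<forall>\<phi>\<in>set \<phi>s. linear_form M \<phi>"
    and dual: "\<And>m. m \<in> mcarrier M \<Longrightarrow> lincomb M xs (map (\<lambda>\<phi>. \<phi> m) \<phi>s) = m"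
    using b by (auto simp: dual_basis_def)
  let ?h = "\<lambda>m. lincomb B (map lft xs) (map (\<lambda>\<phi>. \<phi> m) \<phi>s)"
  have ys: "set (map lft xs) \<subseteq> mcarrier B" using xs lft by auto
  have gl: "map (g \<circ> lft) xs = map f xs" using xs lft by (auto intro!: map_cong)
  have "mhom M B ?h" using mhom_lincomb_forms[OF _ B ys lin] len by simp
  moreover have "g (?h m) = f m" if "m \<in> mcarrier M" for m
  proof -
    have "g (?h m) = lincomb C (map f xs) (map (\<lambda>\<phi>. \<phi> m) \<phi>s)"
      using mhom_lincomb[OF B C g ys, of "map (\<lambda>\<phi>. \<phi> m) \<phi>s"] gl len by simp
    also have "\<dots> = f (lincomb M xs (map (\<lambda>\<phi>. \<phi> m) \<phi>s))"
      using mhom_lincomb[OF M C f xs] len by simp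
    finally show ?thesis using dual[OF that] by simp
  qed
  ultimately show "\<exists>h. mhom M B h \<and> (\<forall>x\<in>mcarrier M. g (h x) = f x)" by blast
qed

text \<open>A dual basis descends to a retract: push the vectors forward along \<open>g\<close> and
  pull the forms back along \<open>f\<close>.\<close>

lemma fgp_retract:
  assumes N: "fgp N" and M: "rmodule M" and f: "mhom M N f" and g: "mhom N M g"
    and gf: "\<And>x. x \<in> mcarrier M \<Longrightarrow> g (f x) = x"
  shows "fgp M"
proof -
  obtain xs \<phi>s where b: "dual_basis N xs \<phi>s" using N fgp_def by blast
  have N': "rmodule N" using N fgp_rmodule by blast
  have "dual_basis M (map g xs) (map (\<lambda>\<phi>. \<phi> \<circ> f) \<phi>s)"
    unfolding dual_basis_def
  proof (intro conjI ballI)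
    show "set (map g xs) \<subseteq> mcarrier M" using b mhom_rules(1)[OF g] by (auto simp: dual_basis_def)
    show "length (map (\<lambda>\<phi>. \<phi> \<circ> f) \<phi>s) = length (map g xs)" using b by (simp add: dual_basis_def)
    show "linear_form M \<psi>" if "\<psi> \<in> set (map (\<lambda>\<phi>. \<phi> \<circ> f) \<phi>s)" for \<psi>
      using that b mhom_rules[OF f] by (auto simp: dual_basis_def linear_form_def)
    fix m assume m: "m \<in> mcarrier M"
    have "lincomb M (map g xs) (map (\<lambda>\<phi>. \<phi> (f m)) \<phi>s) = g (lincomb N xs (map (\<lambda>\<phi>. \<phi> (f m)) \<phi>s))"
      using mhom_lincomb[OF N' M g] b by (simp add: dual_basis_def)
    also have "\<dots> = m" using b gf[OF m] mhom_rules(1)[OF f m] by (simp add: dual_basis_def)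
    finally show "lincomb M (map g xs) (map (\<lambda>\<phi>. \<phi> m) (map (\<lambda>\<phi>. \<phi> \<circ> f) \<phi>s)) = m"
      by (simp add: comp_def)
  qed
  then show ?thesis using M fgp_def by blast
qed

lemma fgp_miso:
  assumes "miso M N" and "fgp M" and "rmodule N"
  shows "fgp N"
  using misoE[OF assms(1) fgp_rmodule[OF assms(2)]] fgp_retract[OF assms(2,3)] by metis

lemma lincomb_append:
  assumes "rmodule M" and "set xs \<subseteq> mcarrier M" and "length rs = length xs"
    and "set ys \<subseteq> mcarrier M" and "length ss = length ys"
  shows "lincomb M (xs @ ys) (rs @ ss) = madd M (lincomb M xs rs) (lincomb M ys ss)"
  using assms(3,2)
  by (induction rs xs rule: list_induct2) (simp_all add: assms rmodule_assoc)

lemma fgp_dsum: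
  assumes "fgp M" and "fgp N"
  shows "fgp (dsum M N)"
proof -
  have M: "rmodule M" and N: "rmodule N" using assms fgp_rmodule by blast+
  obtain xs \<phi>s where xs: "set xs \<subseteq> mcarrier M" "length \<phi>s = length xs"
    and \<phi>s: "\<forall>\<phi>\<in>set \<phi>s. linear_form M \<phi>"
    and dx: "\<And>m. m \<in> mcarrier M \<Longrightarrow> lincomb M xs (map (\<lambda>\<phi>. \<phi> m) \<phi>s) = m"
    using assms(1) unfolding fgp_def dual_basis_def by blast
  obtain ys \<psi>s where ys: "set ys \<subseteq> mcarrier N" "length \<psi>s = length ys"
    and \<psi>s: "\<forall>\<psi>\<in>set \<psi>s. linear_form N \<psi>"
    and dy: "\<And>m. m \<in> mcarrier N \<Longrightarrow> lincomb N ys (map (\<lambda>\<psi>. \<psi> m) \<psi>s) = m"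
    using assms(2) unfolding fgp_def dual_basis_def by blast
  let ?i = "\<lambda>x. (x, mzero N)" and ?j = "\<lambda>y. (mzero M, y)"
  have i: "mhom M (dsum M N) ?i" and j: "mhom N (dsum M N) ?j"
    using M N by (simp_all add: mhom_def)
  have ixs: "set (map ?i xs) \<subseteq> mcarrier (dsum M N)" and jys: "set (map ?j ys) \<subseteq> mcarrier (dsum M N)"
    using xs ys M N by auto
  have "dual_basis (dsum M N) (map ?i xs @ map ?j ys)
          (map (\<lambda>\<phi>. \<phi> \<circ> fst) \<phi>s @ map (\<lambda>\<psi>. \<psi> \<circ> snd) \<psi>s)"
    unfolding dual_basis_def
  proof (intro conjI ballI)
    show "set (map ?i xs @ map ?j ys) \<subseteq> mcarrier (dsum M N)"
      using ixs jys by simp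
    show "length (map (\<lambda>\<phi>. \<phi> \<circ> fst) \<phi>s @ map (\<lambda>\<psi>. \<psi> \<circ> snd) \<psi>s)
        = length (map ?i xs @ map ?j ys)"
      using xs ys by simp
    show "linear_form (dsum M N) \<theta>"
      if "\<theta> \<in> set (map (\<lambda>\<phi>. \<phi> \<circ> fst) \<phi>s @ map (\<lambda>\<psi>. \<psi> \<circ> snd) \<psi>s)" for \<theta>
      using that \<phi>s \<psi>s by (auto simp: linear_form_def)
    fix m assume "m \<in> mcarrier (dsum M N)"
    then obtain x y where m: "m = (x, y)" "x \<in> mcarrier M" "y \<in> mcarrier N" by auto
    let ?rs = "map (\<lambda>\<phi>. \<phi> x) \<phi>s" and ?ss = "map (\<lambda>\<psi>. \<psi> y) \<psi>s"
    have len: "length ?rs = length xs" "length ?ss = length ys" using xs ys by simp_all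
    have "lincomb (dsum M N) (map ?i xs @ map ?j ys) (?rs @ ?ss)
        = madd (dsum M N) (lincomb (dsum M N) (map ?i xs) ?rs) (lincomb (dsum M N) (map ?j ys) ?ss)"
      by (rule lincomb_append[OF rmodule_dsum[OF M N] ixs _ jys]) (simp_all add: xs ys)
    also have "lincomb (dsum M N) (map ?i xs) ?rs = (x, mzero N)"
      using mhom_lincomb[OF M rmodule_dsum[OF M N] i xs(1) len(1)] dx[OF m(2)] by simp
    also have "lincomb (dsum M N) (map ?j ys) ?ss = (mzero M, y)"
      using mhom_lincomb[OF N rmodule_dsum[OF M N] j ys(1) len(2)] dy[OF m(3)] by simp
    also have "madd (dsum M N) (x, mzero N) (mzero M, y) = m" using m M N by simp
    finally show "lincomb (dsum M N) (map ?i xs @ map ?j ys)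
        (map (\<lambda>\<theta>. \<theta> m) (map (\<lambda>\<phi>. \<phi> \<circ> fst) \<phi>s @ map (\<lambda>\<psi>. \<psi> \<circ> snd) \<psi>s)) = m"
      by (simp add: m comp_def)
  qed
  then show ?thesis using M N unfolding fgp_def by (blast intro: rmodule_dsum)
qed

text \<open>The complement is the kernel of \<open>g\<close>, with projection x - f (g x), the
  difference being written through \<open>smul\<close> by - 1. It keeps the carrier type of
  \<open>N\<close>.\<close>

lemma retract_dsum:
  assumes N: "fgp N" and M: "rmodule M" and f: "mhom M N f" and g: "mhom N M g"
    and gf: "\<And>x. x \<in> mcarrier M \<Longrightarrow> g (f x) = x"
  obtains L where "fgp (L :: ('a::ring_1, 'n) rmod)"
    and "miso (dsum (M :: ('a, 'm) rmod) L) (N :: ('a, 'n) rmod)"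
proof -
  have N': "rmodule N" using N fgp_rmodule by blast
  define L where "L = N\<lparr>mcarrier := {x \<in> mcarrier N. g x = mzero M}\<rparr>"
  have sel: "mcarrier L = {x \<in> mcarrier N. g x = mzero M}" "madd L = madd N" "mzero L = mzero N"
    "smul L = smul N" by (simp_all add: L_def)
  have L: "rmodule L"
    unfolding L_def
    by (rule rmodule_submodule) (use N' M mhom_rules[OF g] mhom_zero[OF N' M g] in auto)
  let ?k = "\<lambda>x. madd N x (smul N (f (g x)) (- 1))"
  have fgC: "f (g x) \<in> mcarrier N" if "x \<in> mcarrier N" for x
    using that mhom_rules(1)[OF f] mhom_rules(1)[OF g] by blast
  have gk: "g (?k x) = mzero M" if x: "x \<in> mcarrier N" for x
    using x fgC[OF x] N' M gf mhom_rules[OF g] by simp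
  have k: "mhom N L ?k"
    using fgC gk N' mhom_rules[OF f] mhom_rules[OF g]
    by (auto simp: mhom_def sel rmodule_distrib rmodule_ac)
  have kL: "?k x = x" if "x \<in> mcarrier L" for x
    using that N' by (simp add: sel mhom_zero[OF M N' f])
  have l: "mhom L N id" by (auto simp: mhom_def sel)
  have "fgp L"
    by (rule fgp_retract[OF N L l k]) (use kL in simp)
  moreover have "miso (dsum M L) N"
  proof (rule misoI[where f = "\<lambda>(x, y). madd N (f x) y" and g = "\<lambda>x. (g x, ?k x)"])
    show "mhom (dsum M L) N (\<lambda>(x, y). madd N (f x) y)"
      using N' mhom_rules[OF f]
      by (auto simp: mhom_def sel rmodule_distrib rmodule_ac)
    show "(g y, ?k y) \<in> mcarrier (dsum M L)" if "y \<in> mcarrier N" for y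
      using that mhom_rules(1)[OF g] mhom_rules(1)[OF k] by simp
    show "(case (g y, ?k y) of (x, y) \<Rightarrow> madd N (f x) y) = y" if "y \<in> mcarrier N" for y
    proof -
      have "madd N (f (g y)) (madd N y (smul N (f (g y)) (- 1)))
          = madd N y (madd N (f (g y)) (smul N (f (g y)) (- 1)))"
        using that fgC N' by (simp add: rmodule_left_commute)
      then show ?thesis using that fgC[OF that] N' by simp
    qed
    show "(\<lambda>x. (g x, ?k x)) (case x of (x, y) \<Rightarrow> madd N (f x) y) = x"
      if "x \<in> mcarrier (dsum M L)" for x
    proof -
      obtain m l where ml: "x = (m, l)" "m \<in> mcarrier M" "l \<in> mcarrier N" "g l = mzero M"
        using \<open>x \<in> mcarrier (dsum M L)\<close> by (cases x) (simp add: sel)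
      have fm: "f m \<in> mcarrier N" using mhom_rules(1)[OF f ml(2)] .
      have "g (madd N (f m) l) = m" using ml fm M gf by (simp add: mhom_rules(2)[OF g])
      moreover have "madd N (madd N (f m) l) (smul N (f m) (- 1))
          = madd N l (madd N (f m) (smul N (f m) (- 1)))"
        using ml fm N' by (simp add: rmodule_ac)
      ultimately show ?thesis using ml fm N' by simp
    qed
  qed
  ultimately show thesis by (rule that)
qed

section \<open>The monoid of isomorphism classes\<close>

definition fun_mod :: "(nat \<Rightarrow> 'a::ring_1) set \<Rightarrow> ('a, nat \<Rightarrow> 'a) rmod" where
  "fun_mod S = \<lparr>mcarrier = S, madd = (\<lambda>f g i. f i + g i), mzero = (\<lambda>_. 0),
     smul = (\<lambda>f r i. f i * r)\<rparr>"

lemma fun_mod_sel [simp]: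
  "mcarrier (fun_mod S) = S"
  "madd (fun_mod S) f g = (\<lambda>i. f i + g i)"
  "mzero (fun_mod S) = (\<lambda>_. 0)"
  "smul (fun_mod S) f r = (\<lambda>i. f i * r)"
  by (simp_all add: fun_mod_def)

lemma rmodule_fun_mod:
  assumes "(\<lambda>_. 0) \<in> S"
    and "\<And>f g. f \<in> S \<Longrightarrow> g \<in> S \<Longrightarrow> (\<lambda>i. f i + g i) \<in> S"
    and "\<And>f r. f \<in> S \<Longrightarrow> (\<lambda>i. f i * r) \<in> S"
  shows "rmodule (fun_mod S)"
  by (rule rmoduleI) (simp_all add: assms algebra_simps)

text \<open>The coordinate forms of a dual basis, padded by 0, embed \<open>M\<close> in finitely
  supported sequences, and the dual basis identity inverts the embedding on its image. This reaches
  the carrier type over which \<open>separative\<close> quantifies.\<close>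

lemma fgp_realization:
  fixes M :: "('a::ring_1, 'm) rmod"
  assumes "fgp M"
  obtains N :: "('a, nat \<Rightarrow> 'a) rmod" where "fgp N" and "miso M N"
proof -
  have M: "rmodule M" using assms fgp_rmodule by blast
  obtain xs \<phi>s where len: "length \<phi>s = length xs"
    and lin: "\<forall>\<phi>\<in>set \<phi>s. linear_form M \<phi>"
    and dual: "\<And>m. m \<in> mcarrier M \<Longrightarrow> lincomb M xs (map (\<lambda>\<phi>. \<phi> m) \<phi>s) = m"
    using assms unfolding fgp_def dual_basis_def by blast
  define s where "s m i = (if i < length \<phi>s then (\<phi>s ! i) m else 0)" for m i
  define N where "N = fun_mod (s ` mcarrier M)"
  have s_add: "s (madd M x y) = (\<lambda>i. s x i + s y i)"
    if "x \<in> mcarrier M" and "y \<in> mcarrier M" for x y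
    using that lin by (auto simp: s_def linear_form_def fun_eq_iff)
  have s_smul: "s (smul M x r) = (\<lambda>i. s x i * r)" if "x \<in> mcarrier M" for x r
    using that lin by (auto simp: s_def linear_form_def fun_eq_iff)
  have s_zero: "s (mzero M) = (\<lambda>_. 0)"
    using s_smul[of "mzero M" 0] M by simp
  have inv: "lincomb M xs (map (s m) [0..<length \<phi>s]) = m" if "m \<in> mcarrier M" for m
  proof -
    have "map (s m) [0..<length \<phi>s] = map (\<lambda>\<phi>. \<phi> m) \<phi>s"
      by (rule nth_equalityI) (simp_all add: s_def)
    then show ?thesis using dual[OF that] by simp
  qed
  have N: "rmodule N"
    unfolding N_def
  proof (rule rmodule_fun_mod)
    show "(\<lambda>_. 0) \<in> s ` mcarrier M" using s_zero M by (metis image_eqI rmodule_rules(1))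
    show "(\<lambda>i. f i + g i) \<in> s ` mcarrier M" if "f \<in> s ` mcarrier M" "g \<in> s ` mcarrier M" for f g
    proof -
      obtain x y where "f = s x" "g = s y" and xy: "x \<in> mcarrier M" "y \<in> mcarrier M"
        using \<open>f \<in> s ` mcarrier M\<close> \<open>g \<in> s ` mcarrier M\<close> by blast
      then show ?thesis
        using M by (intro image_eqI[of _ _ "madd M x y"]) (simp_all add: s_add)
    qed
    show "(\<lambda>i. f i * r) \<in> s ` mcarrier M" if "f \<in> s ` mcarrier M" for f r
    proof -
      obtain x where "f = s x" and x: "x \<in> mcarrier M" using \<open>f \<in> s ` mcarrier M\<close> by blast
      then show ?thesis
        using M by (intro image_eqI[of _ _ "smul M x r"]) (simp_all add: s_smul)
    qed
  qed
  have "miso M N"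
    by (rule misoI[where f = s and g = "\<lambda>f. lincomb M xs (map f [0..<length \<phi>s])"])
      (auto simp: mhom_def N_def s_add s_smul inv)
  with fgp_miso[OF this assms N] show thesis by (rule that)
qed

definition fgp_eq :: "('a::ring_1, nat \<Rightarrow> 'a) rmod \<Rightarrow> ('a, nat \<Rightarrow> 'a) rmod \<Rightarrow> bool" where
  "fgp_eq M N \<longleftrightarrow> fgp M \<and> fgp N \<and> miso M N"

definition zero_mod :: "('a::ring_1, nat \<Rightarrow> 'a) rmod" where
  "zero_mod = fun_mod {\<lambda>_. 0}"

lemma zero_mod_sel [simp]:
  "mcarrier zero_mod = {\<lambda>_. 0}" "mzero zero_mod = (\<lambda>_. 0)"
  "madd zero_mod f g = (\<lambda>i. f i + g i)" "smul zero_mod f r = (\<lambda>i. f i * r)"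
  by (simp_all add: zero_mod_def)

lemma fgp_zero_mod: "fgp zero_mod"
  unfolding fgp_def
proof (intro conjI exI)
  show "rmodule zero_mod" unfolding zero_mod_def by (rule rmodule_fun_mod) simp_all
  show "dual_basis zero_mod [] []" by (simp add: dual_basis_def)
qed

lemma dsum_zero_mod:
  assumes "rmodule M"
  shows "miso (dsum zero_mod M) M"
  by (rule misoI[where f = snd and g = "\<lambda>x. (\<lambda>_. 0, x)"])
    (use assms in \<open>auto simp: mhom_def\<close>)

\<comment> \<open>This is the carrier of the monoid V(R). The quotient is partial because the record
  type also contains structures that are not finitely generated projective modules.\<close>
quotient_type (overloaded) 'a proj_class = "('a::ring_1, nat \<Rightarrow> 'a) rmod" / partial: fgp_eq
proof (rule part_equivpI)
  show "\<exists>M :: ('a, nat \<Rightarrow> 'a) rmod. fgp_eq M M"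
    using fgp_zero_mod miso_refl unfolding fgp_eq_def by blast
  show "symp (fgp_eq :: ('a, nat \<Rightarrow> 'a) rmod \<Rightarrow> _)"
    by (rule sympI) (auto simp: fgp_eq_def fgp_rmodule intro: miso_sym)
  show "transp (fgp_eq :: ('a, nat \<Rightarrow> 'a) rmod \<Rightarrow> _)"
    by (rule transpI) (auto simp: fgp_eq_def intro: miso_trans)
qed

definition realization :: "('a::ring_1, 'm) rmod \<Rightarrow> ('a, nat \<Rightarrow> 'a) rmod" where
  "realization M = (SOME N. fgp N \<and> miso M N)"

lemma realization:
  assumes "fgp M"
  shows "fgp (realization M)" and "miso M (realization M)"
proof -
  have "\<exists>N. fgp N \<and> miso M (N :: ('a, nat \<Rightarrow> 'a) rmod)"
    using fgp_realization[OF assms] by blast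
  then have "fgp (realization M) \<and> miso M (realization M)"
    unfolding realization_def by (rule someI_ex)
  then show "fgp (realization M)" and "miso M (realization M)" by simp_all
qed

text \<open>Going through \<open>realization\<close> places modules of every carrier type, such as
  right ideals and direct sums, in one common type of classes.\<close>

definition proj_class :: "('a::ring_1, 'm) rmod \<Rightarrow> 'a proj_class" where
  "proj_class M = abs_proj_class (realization M)"

lemma proj_class_eq_iff:
  fixes M :: "('a::ring_1, 'm) rmod" and N :: "('a, 'n) rmod"
  assumes M: "fgp M" and N: "fgp N"
  shows "proj_class M = proj_class N \<longleftrightarrow> miso M N"
proof -
  note rM = realization[OF M] and rN = realization[OF N]
  have "proj_class M = proj_class N \<longleftrightarrow> fgp_eq (realization M) (realization N)"
    unfolding proj_class_def
    using Quotient3_rel[OF Quotient3_proj_class, of "realization M" "realization N"]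
    by (simp add: fgp_eq_def rM rN miso_refl)
  also have "\<dots> \<longleftrightarrow> miso (realization M) (realization N)"
    using rM rN by (simp add: fgp_eq_def)
  also have "\<dots> \<longleftrightarrow> miso M N"
  proof
    assume "miso (realization M) (realization N)"
    then show "miso M N"
      using rM(2) miso_sym[OF rN(2) fgp_rmodule[OF N]] by (blast intro: miso_trans)
  next
    assume "miso M N"
    then show "miso (realization M) (realization N)"
      using rN(2) miso_sym[OF rM(2) fgp_rmodule[OF M]] by (blast intro: miso_trans)
  qed
  finally show ?thesis .
qed

lemma proj_class_cases:
  obtains M :: "('a::ring_1, nat \<Rightarrow> 'a) rmod" where "fgp M" and "x = proj_class M"
proof -
  define M where "M = rep_proj_class x"
  have M: "fgp_eq M M" "x = abs_proj_class M"
    using Quotient3_rep_reflp[OF Quotient3_proj_class, of x]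
      Quotient3_abs_rep[OF Quotient3_proj_class, of x]
    by (simp_all add: M_def)
  then have f: "fgp M" by (simp add: fgp_eq_def)
  have "fgp_eq M (realization M)" using realization[OF f] f by (simp add: fgp_eq_def)
  then have "x = proj_class M"
    unfolding proj_class_def M(2) using Quotient3_rel[OF Quotient3_proj_class] by blast
  with f show thesis by (rule that)
qed

instantiation proj_class :: (ring_1) comm_monoid_add
begin

definition zero_proj_class :: "'a proj_class" where
  "0 = proj_class zero_mod"

text \<open>The representatives are arbitrary choices; \<open>proj_class_dsum\<close> shows that the
  sum does not depend on them.\<close>

definition plus_proj_class :: "'a proj_class \<Rightarrow> 'a proj_class \<Rightarrow> 'a proj_class" where
  "x + y = proj_class (dsum (SOME M. fgp M \<and> proj_class (M :: ('a, nat \<Rightarrow> 'a) rmod) = x)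
     (SOME N. fgp N \<and> proj_class (N :: ('a, nat \<Rightarrow> 'a) rmod) = y))"

lemma proj_class_dsum:
  fixes M :: "('a::ring_1, 'm) rmod" and N :: "('a, 'n) rmod"
  assumes M: "fgp M" and N: "fgp N"
  shows "proj_class (dsum M N) = proj_class M + proj_class N"
proof -
  have rep: "\<exists>K. fgp K \<and> proj_class (K :: ('a, nat \<Rightarrow> 'a) rmod) = x" for x :: "'a proj_class"
    using proj_class_cases[of x] by metis
  let ?M = "SOME K. fgp K \<and> proj_class (K :: ('a, nat \<Rightarrow> 'a) rmod) = proj_class M"
  let ?N = "SOME K. fgp K \<and> proj_class (K :: ('a, nat \<Rightarrow> 'a) rmod) = proj_class N"
  have m: "fgp ?M" "proj_class ?M = proj_class M"
    using someI_ex[OF rep[of "proj_class M"]] by simp_all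
  have n: "fgp ?N" "proj_class ?N = proj_class N"
    using someI_ex[OF rep[of "proj_class N"]] by simp_all
  have "miso M ?M" "miso N ?N"
    using proj_class_eq_iff[OF M m(1)] proj_class_eq_iff[OF N n(1)] m(2) n(2) by simp_all
  then have "miso (dsum M N) (dsum ?M ?N)"
    by (rule dsum_cong[OF _ _ fgp_rmodule[OF M] fgp_rmodule[OF N]])
  then show ?thesis
    unfolding plus_proj_class_def
    using proj_class_eq_iff[OF fgp_dsum[OF M N] fgp_dsum[OF m(1) n(1)]] by simp
qed

instance
proof
  fix x y z :: "'a proj_class"
  obtain A :: "('a, nat \<Rightarrow> 'a) rmod" where A: "fgp A" "x = proj_class A"
    by (rule proj_class_cases)
  obtain B :: "('a, nat \<Rightarrow> 'a) rmod" where B: "fgp B" "y = proj_class B"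
    by (rule proj_class_cases)
  obtain C :: "('a, nat \<Rightarrow> 'a) rmod" where C: "fgp C" "z = proj_class C"
    by (rule proj_class_cases)
  have "proj_class (dsum (dsum A B) C) = proj_class (dsum A (dsum B C))"
    by (rule proj_class_eq_iff[THEN iffD2, OF _ _ dsum_assoc]) (simp_all add: A B C fgp_dsum)
  then show "x + y + z = x + (y + z)"
    by (simp add: A B C proj_class_dsum fgp_dsum)
  have "proj_class (dsum A B) = proj_class (dsum B A)"
    by (rule proj_class_eq_iff[THEN iffD2, OF _ _ dsum_commute]) (simp_all add: A B fgp_dsum)
  then show "x + y = y + x"
    by (simp only: A B proj_class_dsum)
  have "proj_class (dsum zero_mod A) = proj_class A"
    by (rule proj_class_eq_iff[THEN iffD2, OF _ _ dsum_zero_mod])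
      (simp_all add: A fgp_dsum fgp_zero_mod fgp_rmodule)
  then show "0 + x = x"
    by (simp add: A zero_proj_class_def proj_class_dsum fgp_zero_mod)
qed

end

lemma separative_proj_class:
  fixes x y :: "'a::ring_1 proj_class"
  assumes "separative TYPE('a)" and "x + x = x + y" and "x + y = y + y"
  shows "x = y"
proof -
  obtain A :: "('a, nat \<Rightarrow> 'a) rmod" where A: "fgp A" "x = proj_class A"
    by (rule proj_class_cases)
  obtain B :: "('a, nat \<Rightarrow> 'a) rmod" where B: "fgp B" "y = proj_class B"
    by (rule proj_class_cases)
  have "proj_class (dsum A A) = proj_class (dsum A B)"
    and "proj_class (dsum A B) = proj_class (dsum B B)"
    using assms(2,3) by (simp_all only: A B proj_class_dsum)
  then have "miso (dsum A A) (dsum A B)" and "miso (dsum A B) (dsum B B)"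
    using proj_class_eq_iff[of "dsum A A" "dsum A B"] proj_class_eq_iff[of "dsum A B" "dsum B B"] A B
    by (simp_all add: fgp_dsum)
  then have "miso A B"
    using assms(1)[unfolded separative_def, rule_format, of A B] A B
    by (simp add: fgp_fin_gen fgp_projective)
  then show ?thesis using A B by (simp add: proj_class_eq_iff)
qed

text \<open>Being a direct summand becomes the algebraic preorder of V(R), the form in which the
  cancellation argument consumes it.\<close>

lemma proj_class_retract:
  fixes M :: "('a::ring_1, 'm) rmod" and N :: "('a, 'n) rmod"
  assumes N: "fgp N" and M: "rmodule M" and f: "mhom M N f" and g: "mhom N M g"
    and gf: "\<And>x. x \<in> mcarrier M \<Longrightarrow> g (f x) = x"
  obtains c where "proj_class N = proj_class M + c"
proof -
  obtain L :: "('a, 'n) rmod" where L: "fgp L" "miso (dsum M L) N"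
    using retract_dsum[OF N M f g gf] by blast
  have "fgp M" by (rule fgp_retract[OF N M f g gf])
  then have "proj_class (dsum M L) = proj_class N"
    using L N by (simp add: proj_class_eq_iff fgp_dsum)
  then have "proj_class N = proj_class M + proj_class L"
    using \<open>fgp M\<close> L(1) by (simp add: proj_class_dsum)
  then show thesis by (rule that)
qed

section \<open>Cancellation in separative commutative monoids\<close>

primrec mult_of :: "nat \<Rightarrow> 'm::comm_monoid_add \<Rightarrow> 'm" where
  "mult_of 0 x = 0"
| "mult_of (Suc n) x = x + mult_of n x"

lemma mult_of_add: "mult_of (m + n) x = mult_of m x + mult_of n x"
  by (induction m) (simp_all add: add.assoc)

text \<open>The multiplicity is lowered one step at a time. Each of the two equations descends on
  its own; they are combined only at multiplicity 1, where they are the premises of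
  \<open>sep\<close>.\<close>

lemma separative_cancel_mult:
  fixes x y :: "'m::comm_monoid_add"
  assumes sep: "\<And>x y :: 'm. x + x = x + y \<Longrightarrow> x + y = y + y \<Longrightarrow> x = y"
    and "mult_of n x + x = mult_of n x + y" and "mult_of n y + y = mult_of n y + x"
  shows "x = y"
  using assms(2,3)
proof (induction n)
  case 0
  then show ?case by simp
next
  case (Suc n)
  have descend: "mult_of n u + u = mult_of n u + v"
    if h: "mult_of (Suc n) u + u = mult_of (Suc n) u + v" and "n \<noteq> 0" for u v :: 'm
  proof -
    obtain k where k: "n = Suc k" using \<open>n \<noteq> 0\<close> by (cases n) auto
    let ?t = "mult_of k u"
    have h': "u + (u + (u + ?t)) = v + (u + (u + ?t))" using h k by (simp add: ac_simps)
    \<comment> \<open>By \<open>h'\<close>, a u may be exchanged for v beside k + 2 further copies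
      of u. X + X and X + Y leave 2k + 3 and 2k + 2 such copies, so one exchange turns X + X into X
      + Y and another turns X + Y into Y + Y. Here k \<ge> 0 matters, which is why n = 0 is
      excluded.\<close>
    let ?X = "u + (u + ?t)" and ?Y = "v + (u + ?t)"
    have XY: "?X + ?X = ?X + ?Y"
    proof -
      have "?X + ?X = (u + (u + (u + ?t))) + (u + ?t)" by (simp add: ac_simps)
      also have "\<dots> = (v + (u + (u + ?t))) + (u + ?t)" by (simp only: h')
      finally show ?thesis by (simp add: ac_simps)
    qed
    have "?X + ?Y = v + (u + (u + (u + ?t))) + ?t" by (simp add: ac_simps)
    also have "\<dots> = v + (v + (u + (u + ?t))) + ?t" by (simp only: h')
    also have "\<dots> = ?Y + ?Y" by (simp add: ac_simps)
    finally have "?X = ?Y" by (rule sep[OF XY])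
    then show ?thesis using k by (simp add: ac_simps)
  qed
  show ?case
  proof (cases "n = 0")
    case True
    then have "x + x = x + y" and "y + y = y + x" using Suc.prems by simp_all
    then show ?thesis by (intro sep[of x y]) (simp_all add: add.commute)
  next
    case False
    show ?thesis
      by (rule Suc.IH[OF descend[OF Suc.prems(1) False] descend[OF Suc.prems(2) False]])
  qed
qed

text \<open>Beside any multiple that contains c, the elements x and y are interchangeable, since x +
  c = y + c. Adding n copies of x, respectively m copies of y, brings the two resulting equations to
  the common multiplicity m + n.\<close>

lemma separative_cancel:
  fixes x y c :: "'m::comm_monoid_add"
  assumes sep: "\<And>x y :: 'm. x + x = x + y \<Longrightarrow> x + y = y + y \<Longrightarrow> x = y"
    and eq: "x + c = y + c" and "mult_of m x = c + d" and "mult_of n y = c + e"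
  shows "x = y"
proof (rule separative_cancel_mult[where n = "m + n"])
  have absorb: "u + v = u + w" if "u = c + t" and "v + c = w + c" for t u v w
  proof -
    have "u + v = (v + c) + t" by (simp add: that(1) ac_simps)
    also have "\<dots> = (w + c) + t" by (simp only: that(2))
    finally show ?thesis by (simp add: that(1) ac_simps)
  qed
  have "mult_of m x + x = mult_of m x + y" by (rule absorb[OF assms(3) eq])
  then have "mult_of n x + (mult_of m x + x) = mult_of n x + (mult_of m x + y)" by (rule arg_cong)
  then show "mult_of (m + n) x + x = mult_of (m + n) x + y"
    unfolding mult_of_add add.commute[of "mult_of m x" "mult_of n x"] by (simp only: add.assoc)
  have "mult_of n y + y = mult_of n y + x" by (rule absorb[OF assms(4) eq[symmetric]])
  then have "mult_of m y + (mult_of n y + y) = mult_of m y + (mult_of n y + x)" by (rule arg_cong)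
  then show "mult_of (m + n) y + y = mult_of (m + n) y + x"
    unfolding mult_of_add by (simp only: add.assoc)
qed (fact sep)

section \<open>Classes of idempotents\<close>

text \<open>For idempotent \<open>e\<close> this is the right ideal eR; the fixed point equation
  avoids a witness for membership.\<close>

definition cyc_mod :: "'a::ring_1 \<Rightarrow> ('a, 'a) rmod" where
  "cyc_mod e = \<lparr>mcarrier = {x. e * x = x}, madd = (+), mzero = 0, smul = (*)\<rparr>"

lemma cyc_mod_sel [simp]:
  "x \<in> mcarrier (cyc_mod e) \<longleftrightarrow> e * x = x"
  "madd (cyc_mod e) = (+)" "mzero (cyc_mod e) = 0" "smul (cyc_mod e) = (*)"
  by (simp_all add: cyc_mod_def)

lemma rmodule_cyc_mod: "rmodule (cyc_mod e)"
  by (rule rmoduleI) (simp_all add: algebra_simps flip: mult.assoc)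

lemma fgp_cyc_mod:
  assumes "e * e = e"
  shows "fgp (cyc_mod e)"
proof -
  have "dual_basis (cyc_mod e) [e] [\<lambda>x. x]"
    using assms by (auto simp: dual_basis_def linear_form_def)
  then show ?thesis using rmodule_cyc_mod unfolding fgp_def by blast
qed

abbreviation idem_class :: "'a::ring_1 \<Rightarrow> 'a proj_class" where
  "idem_class e \<equiv> proj_class (cyc_mod e)"

lemma idem_class_eqI:
  assumes "e * e = e" and "f * f = f" and uv: "u * v = f" and vu: "v * u = e"
  shows "idem_class e = idem_class f"
proof -
  have vux: "v * (u * x) = e * x" and uvx: "u * (v * x) = f * x" for x
    by (simp_all add: uv vu flip: mult.assoc)
  have 1: "f * (u * x) = u * x" if "e * x = x" for x
    using uvx[of "u * x"] vux[of x] that by simp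
  have 2: "e * (v * y) = v * y" if "f * y = y" for y
    using vux[of "v * y"] uvx[of y] that by simp
  have "miso (cyc_mod e) (cyc_mod f)"
    by (rule misoI[where f = "(*) u" and g = "(*) v"])
      (simp_all add: mhom_def 1 2 vux uvx distrib_left mult.assoc)
  then show ?thesis by (simp add: proj_class_eq_iff fgp_cyc_mod assms(1,2))
qed

text \<open>A homomorphism on eR is left multiplication by its value at e. An isomorphism and its
  inverse thus become two ring elements, and the remaining work can be done by computation in
  R.\<close>

lemma idem_class_eqE:
  assumes e: "e * e = e" and f: "f * f = f" and "idem_class e = idem_class f"
  obtains u v where "u * v = f" and "v * u = e" and "f * u = u" and "u * e = u"
    and "e * v = v"
proof -
  have "miso (cyc_mod e) (cyc_mod f)"
    using assms by (simp add: proj_class_eq_iff fgp_cyc_mod)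
  then obtain \<phi> \<psi> where \<phi>: "mhom (cyc_mod e) (cyc_mod f) \<phi>" and \<psi>: "mhom (cyc_mod f) (cyc_mod e) \<psi>"
    and \<psi>\<phi>: "\<And>x. x \<in> mcarrier (cyc_mod e) \<Longrightarrow> \<psi> (\<phi> x) = x"
    and \<phi>\<psi>: "\<And>y. y \<in> mcarrier (cyc_mod f) \<Longrightarrow> \<phi> (\<psi> y) = y"
    using misoE[OF _ rmodule_cyc_mod] by blast
  have 1: "f * \<phi> e = \<phi> e" and 2: "e * \<psi> f = \<psi> f"
    using mhom_rules(1)[OF \<phi>, of e] mhom_rules(1)[OF \<psi>, of f] e f by simp_all
  have \<phi>x: "\<phi> e * x = \<phi> (e * x)" for x using mhom_rules(3)[OF \<phi>, of e x] e by simp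
  have \<psi>x: "\<psi> f * x = \<psi> (f * x)" for x using mhom_rules(3)[OF \<psi>, of f x] f by simp
  show thesis
  proof (rule that)
    show "\<phi> e * \<psi> f = f" using \<phi>x[of "\<psi> f"] 2 \<phi>\<psi>[of f] f by simp
    show "\<psi> f * \<phi> e = e" using \<psi>x[of "\<phi> e"] 1 \<psi>\<phi>[of e] e by simp
    show "\<phi> e * e = \<phi> e" using \<phi>x[of e] e by simp
  qed (fact 1 2)+
qed

lemma idem_class_add:
  assumes e: "e * e = e" and f: "f * f = f" and ef: "e * f = 0" and fe: "f * e = 0"
  shows "idem_class (e + f) = idem_class e + idem_class f"
proof -
  have ef_idem: "(e + f) * (e + f) = e + f" by (simp add: algebra_simps assms)
  have ex: "f * x = 0" if "e * x = x" for x using fe that by (metis mult.assoc mult_zero_left)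
  have fx: "e * x = 0" if "f * x = x" for x using ef that by (metis mult.assoc mult_zero_left)
  have "miso (dsum (cyc_mod e) (cyc_mod f)) (cyc_mod (e + f))"
    by (rule misoI[where f = "\<lambda>(x, y). x + y" and g = "\<lambda>z. (e * z, f * z)"])
      (auto simp: mhom_def algebra_simps ex fx e f simp flip: mult.assoc)
  then have "proj_class (dsum (cyc_mod e) (cyc_mod f)) = idem_class (e + f)"
    by (simp add: proj_class_eq_iff fgp_cyc_mod fgp_dsum e f ef_idem)
  then show ?thesis by (simp add: proj_class_dsum fgp_cyc_mod e f)
qed

section \<open>Multiples of an idempotent class and the ideal generated by an idempotent\<close>

definition pow_mod :: "'a::ring_1 \<Rightarrow> nat \<Rightarrow> ('a, nat \<Rightarrow> 'a) rmod" where
  "pow_mod e n = fun_mod {h. (\<forall>i<n. e * h i = h i) \<and> (\<forall>i\<ge>n. h i = 0)}"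

lemma rmodule_pow_mod: "rmodule (pow_mod e n)"
  unfolding pow_mod_def by (rule rmodule_fun_mod) (simp_all add: distrib_left flip: mult.assoc)

lemma pow_mod:
  fixes e :: "'a::ring_1"
  assumes e: "e * e = e"
  shows "fgp (pow_mod e n)" and "proj_class (pow_mod e n) = mult_of n (idem_class e)"
proof (induction n)
  case 0
  have "pow_mod e 0 = zero_mod"
    unfolding pow_mod_def zero_mod_def by (rule arg_cong[where f = fun_mod]) auto
  then show "fgp (pow_mod e 0)" and "proj_class (pow_mod e 0) = mult_of 0 (idem_class e)"
    by (simp_all add: fgp_zero_mod zero_proj_class_def)
next
  case (Suc n)
  have iso: "miso (dsum (cyc_mod e) (pow_mod e n)) (pow_mod e (Suc n))"
  \<comment> \<open>The new coordinate goes to index n, so no index is shifted. Since tuples of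
    length n vanish from n on, resetting that entry to 0 recovers the old tuple.\<close>
  proof (rule misoI[where f = "\<lambda>(x, h) i. if i = n then x else h i" and g = "\<lambda>h. (h n, h(n := 0))"])
    show "mhom (dsum (cyc_mod e) (pow_mod e n)) (pow_mod e (Suc n))
        (\<lambda>(x, h) i. if i = n then x else h i)"
      by (auto simp: mhom_def pow_mod_def less_Suc_eq)
  qed (auto simp: pow_mod_def less_Suc_eq)
  have d: "fgp (dsum (cyc_mod e) (pow_mod e n))"
    by (rule fgp_dsum[OF fgp_cyc_mod[OF e] Suc.IH(1)])
  show F: "fgp (pow_mod e (Suc n))"
    by (rule fgp_miso[OF iso d rmodule_pow_mod])
  have "proj_class (pow_mod e (Suc n)) = proj_class (dsum (cyc_mod e) (pow_mod e n))"
    using proj_class_eq_iff[OF d F] iso by simp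
  then show "proj_class (pow_mod e (Suc n)) = mult_of (Suc n) (idem_class e)"
    using Suc.IH by (simp add: proj_class_dsum fgp_cyc_mod e)
qed

text \<open>The map m \<mapsto> (e y_i m) from wR to (eR)^n has the retraction (h_i) \<mapsto> w
  (x_1 h_1 + ... + x_n h_n), because the composite is left multiplication by w * w. So lying in the
  ideal generated by e makes wR a summand of a power of eR.\<close>

lemma idem_class_le_mult:
  fixes e w :: "'a::ring_1"
  assumes e: "e * e = e" and w: "w * w = w" and sum: "w = (\<Sum>i<n. x i * e * y i)"
  obtains c where "mult_of n (idem_class e) = idem_class w + c"
proof -
  define f where "f m i = (if i < n then e * y i * m else 0)" for m i
  define g where "g h = w * (\<Sum>i<n. x i * h i)" for h
  have f: "mhom (cyc_mod w) (pow_mod e n) f"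
    by (auto simp: mhom_def pow_mod_def fun_eq_iff f_def distrib_left e simp flip: mult.assoc)
  have g: "mhom (pow_mod e n) (cyc_mod w) g"
    by (auto simp: mhom_def pow_mod_def distrib_left g_def sum.distrib w sum_distrib_right mult.assoc
        simp flip: mult.assoc[of w w])
  have gf: "g (f m) = m" if "m \<in> mcarrier (cyc_mod w)" for m
  proof -
    have "(\<Sum>i<n. x i * f m i) = (\<Sum>i<n. x i * e * y i) * m"
      by (simp add: f_def sum_distrib_right mult.assoc)
    then show ?thesis using that w by (simp add: g_def flip: sum)
  qed
  obtain c where "proj_class (pow_mod e n) = idem_class w + c"
    by (rule proj_class_retract[OF pow_mod(1)[OF e] rmodule_cyc_mod f g]) (use gf in blast)
  then show thesis using pow_mod(2)[OF e] by (intro that) simp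
qed

text \<open>A section of R \<rightarrow> R/K sends the coset of 1 to some q. It kills K because the
  section is linear on cosets, and 1 - q is in K because it is a section; hence q (1 - q) = 0 and K
  = (1 - q)R.\<close>

lemma projective_quotient_split:
  fixes K :: "'a::ring_1 set"
  assumes proj: "projective (quot_mod UNIV K)"
    and K0: "0 \<in> K" and Kadd: "\<And>x y. x \<in> K \<Longrightarrow> y \<in> K \<Longrightarrow> x + y \<in> K"
    and Kmul: "\<And>x r. x \<in> K \<Longrightarrow> x * r \<in> K"
  obtains q where "q * q = q" and "1 - q \<in> K" and "\<And>x. x \<in> K \<Longrightarrow> q * x = 0"
proof -
  let ?Q = "quot_mod UNIV K"
  have Q: "rmodule ?Q" using proj unfolding projective_def by blast
  have Kdiff: "x - y \<in> K" if "x \<in> K" "y \<in> K" for x y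
    using Kadd[OF that(1) Kmul[OF that(2), of "- 1"]] by simp
  define coset where "coset x = {z. z - x \<in> K}" for x
  have coset: "{x + k |k. k \<in> K} = coset x" for x
    unfolding coset_def by (auto simp: algebra_simps intro: exI[of _ "_ - x"])
  have coset_eq: "coset x = coset y \<longleftrightarrow> x - y \<in> K" for x y
  proof
    assume "coset x = coset y"
    moreover have "x \<in> coset x" by (simp add: coset_def K0)
    ultimately show "x - y \<in> K" by (simp add: coset_def)
  next
    assume xy: "x - y \<in> K"
    have "z - x \<in> K \<longleftrightarrow> z - y \<in> K" for z
      using Kadd[OF _ xy, of "z - x"] Kdiff[OF _ xy, of "z - y"] by (auto simp: algebra_simps)
    then show "coset x = coset y" by (simp add: coset_def)
  qed
  have carrier: "mcarrier ?Q = range coset" by (auto simp: quot_mod_def coset)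
  have add: "madd ?Q (coset x) (coset y) = coset (x + y)" for x y
  proof -
    have "z - (x + y) \<in> K" if "z - (x' + y') \<in> K" "x' - x \<in> K" "y' - y \<in> K" for z x' y'
      using Kadd[OF that(1) Kadd[OF that(2,3)]] by (simp add: algebra_simps)
    moreover have "\<exists>x'\<in>coset x. \<exists>y'\<in>coset y. z - (x' + y') \<in> K" if "z \<in> coset (x + y)" for z
      using that K0 by (intro bexI[of _ x] bexI[of _ y]) (simp_all add: coset_def)
    ultimately show ?thesis by (auto simp: quot_mod_def coset_def)
  qed
  have mul: "smul ?Q (coset x) r = coset (x * r)" for x r
  proof -
    have "z - x * r \<in> K" if "z - x' * r \<in> K" "x' - x \<in> K" for z x'
      using Kadd[OF that(1) Kmul[OF that(2), of r]] by (simp add: algebra_simps)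
    then show ?thesis by (auto simp: quot_mod_def coset_def K0 intro!: exI[of _ x])
  qed
  \<comment> \<open>The test module has to live in \<open>'a set \<Rightarrow> 'a\<close>. R is
    copied there as the constant functions and read back by evaluation at \<open>{}\<close>.\<close>
  define B :: "('a, 'a set \<Rightarrow> 'a) rmod" where
    "B = \<lparr>mcarrier = range (\<lambda>x _. x), madd = (\<lambda>f g s. f s + g s), mzero = (\<lambda>_. 0),
      smul = (\<lambda>f r s. f s * r)\<rparr>"
  have B: "rmodule B"
    by (rule rmoduleI) (auto simp: B_def algebra_simps)
  have g: "mhom B ?Q (\<lambda>f. coset (f {}))"
    by (auto simp: mhom_def carrier add mul B_def)
  have sur: "(\<lambda>f. coset (f {})) ` mcarrier B = mcarrier ?Q"
    by (simp add: carrier B_def image_image)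
  have "mhom ?Q ?Q id" by (simp add: mhom_def)
  then have "\<exists>h. mhom ?Q B h \<and> (\<forall>X\<in>mcarrier ?Q. coset (h X {}) = id X)"
    using proj[unfolded projective_def, THEN conjunct2, rule_format,
        of B ?Q "\<lambda>f. coset (f {})" id] B Q g sur by blast
  then obtain h where h: "mhom ?Q B h"
    and gh: "\<And>X. X \<in> mcarrier ?Q \<Longrightarrow> coset (h X {}) = X"
    by auto
  define q where "q = h (coset 1) {}"
  have "h (coset 1 ) \<in> mcarrier B" using mhom_rules(1)[OF h] carrier by blast
  have hx: "h (coset x) {} = q * x" for x
    using mhom_rules(3)[OF h, of "coset 1" x] carrier by (simp add: mul B_def q_def)
  have kill: "q * x = 0" if "x \<in> K" for x
  proof -
    have "coset x = coset 0" using that by (simp add: coset_eq)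
    then have "q * x = q * 0" by (metis hx)
    then show ?thesis by simp
  qed
  have "coset q = coset 1" using gh[of "coset 1"] carrier by (simp add: q_def)
  then have K1: "1 - q \<in> K" by (metis coset_eq)
  with kill[OF K1] have "q * q = q" by (simp add: algebra_simps)
  then show thesis using K1 kill by (rule that)
qed

section \<open>Special clean elements\<close>

lemma idem_class_le_ideal:
  fixes e w d y :: "'a::ring_1"
  assumes e: "e * e = e" and w: "w * w = w" "w = d * y"
    and d: "d \<in> ideal_gen S" and S: "\<And>s. s \<in> S \<Longrightarrow> \<exists>u v. s = u * e * v"
  obtains n c where "mult_of n (idem_class e) = idem_class w + c"
proof -
  obtain n :: nat and x s z where ds: "d = (\<Sum>i<n. x i * s i * z i)" and s: "\<forall>i<n. s i \<in> S"
    using d unfolding ideal_gen_def by blast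
  have "\<forall>i. \<exists>u v. i < n \<longrightarrow> s i = u * e * v" using s S by blast
  then obtain u v where uv: "\<And>i. i < n \<Longrightarrow> s i = u i * e * v i" by metis
  have "w = (\<Sum>i<n. (x i * u i) * e * (v i * z i * y))"
    unfolding w(2) ds sum_distrib_right by (rule sum.cong) (simp_all add: uv mult.assoc)
  then obtain c where "mult_of n (idem_class e) = idem_class w + c"
    by (rule idem_class_le_mult[OF e w(1)])
  then show thesis by (rule that)
qed

text \<open>Lets an equation for a product of two factors rewrite at the head of a right-nested
  product.\<close>

lemma mult_assoc_eq: "x * y = z \<Longrightarrow> x * (y * t) = z * (t :: 'a::semigroup_mult)"
  by (metis mult.assoc)

text \<open>Here w = d y projects onto W = dR, g onto the complement dqR of aW in W, and h = w - g
  onto aW. A section t of a over aW makes h' = t a w an idempotent equivalent to h, and p = w - h'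
  projects onto the kernel of a on W. The class c is that of aW.\<close>

lemma kernel_cokernel_classes:
  fixes a d y q s k :: "'a::ring_1"
  assumes d: "d = a - a * a * a" and y: "d * y * d = d"
    and q: "q * q = q" "q * a = 0" "\<And>x. a * x = 0 \<Longrightarrow> q * x = 0"
    and sk: "1 - q = a * s + k" "a * k = 0"
  obtains p c where "p * p = p" and "a * p = 0" and "p \<in> rprinc a"
    and "\<And>x. x \<in> rprinc a \<Longrightarrow> a * x = 0 \<Longrightarrow> p * x = x"
    and "idem_class (d * y) = idem_class p + c" and "idem_class (d * y) = idem_class q + c"
proof -
  define w where "w = d * y"
  have wd: "w * d = d" using y by (simp add: w_def)
  have w: "w * w = w" unfolding w_def using mult_assoc_eq[OF y] by simp
  have ad: "a * d = d * a" by (simp add: d algebra_simps)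
  have qyd: "q * y * d = q"
  proof -
    \<comment> \<open>r generates the right annihilator of d, and a (r - a^2 r) = d r = 0 puts it in
      aR + r(a), where q vanishes.\<close>
    define r where "r = 1 - y * d"
    have "d * r = 0" using y by (simp add: r_def right_diff_distrib mult.assoc)
    then have "a * (r - a * (a * r)) = 0" by (simp add: d algebra_simps)
    then have "q * (r - a * (a * r)) = 0" by (rule q(3))
    then have "q * r = 0" using q(2) by (simp add: right_diff_distrib flip: mult.assoc)
    then show ?thesis by (simp add: r_def right_diff_distrib mult.assoc)
  qed
  define g where "g = d * q * y"
  have gd: "g * d = d * q" unfolding g_def using qyd by (simp add: mult.assoc)
  have wg: "w * g = g" unfolding g_def using wd by (simp flip: mult.assoc)
  have "g * w = d * (q * y * d) * y" by (simp add: g_def w_def mult.assoc)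
  then have gw: "g * w = g" by (simp add: qyd g_def)
  have "g * g = g * d * (q * y)" by (simp add: g_def mult.assoc)
  also have "\<dots> = d * (q * q) * y" by (simp only: gd mult.assoc)
  finally have g: "g * g = g" by (simp only: q(1) g_def)
  define h where "h = w - g"
  have h: "h * h = h" and gh: "g * h = 0" and hg: "h * g = 0" and wh: "w * h = h" and hw: "h * w = h"
    using w g wg gw by (simp_all add: h_def algebra_simps)
  have aw: "a * w = d * (a * y)" by (simp add: w_def mult_assoc_eq[OF ad] mult.assoc)
  have waw: "w * (a * w) = a * w" unfolding aw by (rule mult_assoc_eq[OF wd])
  have gaw: "g * (a * w) = 0"
    by (simp add: aw mult_assoc_eq[OF gd] mult.assoc mult_assoc_eq[OF q(2)])
  have haw: "h * (a * w) = a * w" unfolding h_def using waw gaw by (simp add: left_diff_distrib)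
  \<comment> \<open>Since d k = 0, the splitting of 1 - q gives h = d (1 - q) y = a d s y. So d s y
    h is a preimage of h under a that lies in W.\<close>
  define t where "t = d * s * y * h"
  have "d * k = 0" using sk(2) by (simp add: d left_diff_distrib mult.assoc)
  have "h = d * (1 - q) * y" by (simp add: h_def w_def g_def algebra_simps)
  also have "\<dots> = d * a * s * y"
    unfolding sk(1) using \<open>d * k = 0\<close> by (simp add: distrib_left flip: mult.assoc)
  finally have hdas: "h = a * d * s * y" by (simp add: ad)
  have at: "a * t = h" using h hdas by (simp add: t_def mult.assoc)
  have wt: "w * t = t" using wd by (simp add: t_def flip: mult.assoc)
  define h' where "h' = t * (a * w)"
  have awt: "a * w * t = h" using wt at by (simp add: mult.assoc)
  have h': "h' * h' = h'"
    unfolding h'_def using mult_assoc_eq[OF awt] haw by (simp add: mult.assoc)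
  have wh': "w * h' = h'" and h'w: "h' * w = h'"
    unfolding h'_def using wt w by (simp_all add: mult.assoc mult_assoc_eq[OF wt])
  define p where "p = w - h'"
  have p: "p * p = p" and ph': "p * h' = 0" and h'p: "h' * p = 0" and wp: "w * p = p"
    using w h' wh' h'w by (simp_all add: p_def algebra_simps)
  have ap: "a * p = 0"
    unfolding p_def h'_def right_diff_distrib mult_assoc_eq[OF at] haw by simp
  have "p = a * ((1 - a * a) * y * p)"
    using wp by (simp add: w_def d algebra_simps)
  then have prin: "p \<in> rprinc a" unfolding rprinc_def by blast
  have px: "p * x = x" if "x \<in> rprinc a" "a * x = 0" for x
  proof -
    obtain z where z: "x = a * z" using \<open>x \<in> rprinc a\<close> by (auto simp: rprinc_def)
    have "d * z = x" using that(2) by (simp add: d z algebra_simps)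
    then have "w * x = x" using mult_assoc_eq[OF wd, of z] by simp
    then show ?thesis using that(2) by (simp add: p_def h'_def left_diff_distrib mult.assoc)
  qed
  have qg: "idem_class q = idem_class g"
  proof (rule idem_class_eqI[OF q(1) g])
    show "d * q * (q * y) = g" by (simp add: g_def mult.assoc mult_assoc_eq[OF q(1)])
    show "q * y * (d * q) = q" by (simp only: mult_assoc_eq[OF qyd] q(1))
  qed
  have hh': "idem_class h' = idem_class h"
    by (rule idem_class_eqI[OF h' h, where u = "a * w" and v = t]) (simp_all add: awt h'_def)
  have "idem_class w = idem_class g + idem_class h"
    using idem_class_add[OF g h gh hg] by (simp add: h_def)
  moreover have "idem_class w = idem_class p + idem_class h'"
    using idem_class_add[OF p h' ph' h'p] by (simp add: p_def)
  ultimately have "idem_class (d * y) = idem_class q + idem_class h"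
    and "idem_class (d * y) = idem_class p + idem_class h"
    by (simp_all add: qg hh' flip: w_def)
  then show thesis using that[OF p ap prin px] by blast
qed

text \<open>p q may be nonzero, so p is replaced by p' = p (1 - q), which generates the same right
  ideal. The pieces i and k come from 1 - q = a s + n after removing the parts along p and q.
  Idempotence and the remaining orthogonality are forced by the four pieces summing to 1.\<close>

lemma kernel_range_decomposition:
  fixes a b p q s n :: "'a::ring_1"
  assumes b: "a * b * a = a"
    and p: "p * p = p" "a * p = 0" "p \<in> rprinc a"
      "\<And>x. x \<in> rprinc a \<Longrightarrow> a * x = 0 \<Longrightarrow> p * x = x"
    and q: "q * q = q" "q * a = 0" "\<And>x. a * x = 0 \<Longrightarrow> q * x = 0"
    and sk: "1 - q = a * s + n" "a * n = 0"
  obtains p' k i where "p' * p = p" and "p * p' = p'" and "p' * p' = p'" and "k * k = k" and "i * i = i"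
    and "p' + k + i + q = 1"
    and "p' * k = 0" and "p' * i = 0" and "p' * q = 0" and "k * p' = 0" and "k * i = 0" and "k * q = 0"
    and "i * p' = 0" and "i * k = 0" and "i * q = 0" and "q * p' = 0" and "q * k = 0" and "q * i = 0"
    and "a * p' = 0" and "a * k = 0" and "\<And>x. a * x = 0 \<Longrightarrow> (p' + k) * x = x"
    and "(p' + i) * a = a" and "p' + i \<in> rprinc a"
proof -
  define f where "f = a * b"
  have fa: "f * a = a" using b by (simp add: f_def mult.assoc)
  have fp: "f * p = p"
    using p(3) mult_assoc_eq[OF fa] by (auto simp: rprinc_def)
  have px: "p * x = x" if "f * x = x" and "a * x = 0" for x
  proof (rule p(4))
    have "x = a * (b * x)" using that(1) by (simp add: f_def mult.assoc)
    then show "x \<in> rprinc a" unfolding rprinc_def by blast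
  qed fact
  \<comment> \<open>The engine of the nontrivial vanishing products below: an element of aR \<inter>
    r(a) is fixed by p, so it is 0 if p kills it.\<close>
  have zero: "x = 0" if "f * x = x" and "a * x = 0" and "p * x = 0" for x
    using px[OF that(1,2)] that(3) by simp
  have qp: "q * p = 0" and qn: "q * n = 0" using q(3) p(2) sk(2) by simp_all
  define p' where "p' = p * (1 - q)"
  define i where "i = (1 - p) * (a * s) * (1 - q)"
  define k where "k = (1 - p) * n * (1 - q)"
  have p'p: "p' * p = p" and pp': "p * p' = p'"
    using qp p(1) by (simp_all add: p'_def left_diff_distrib right_diff_distrib mult.assoc
        mult_assoc_eq[OF p(1)])
  have p'q: "p' * q = 0" and iq: "i * q = 0" and kq: "k * q = 0"
    using q(1) by (simp_all add: p'_def i_def k_def left_diff_distrib right_diff_distrib mult.assoc)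
  have qp': "q * p' = 0" and qi: "q * i = 0" and qk: "q * k = 0"
    by (simp_all add: p'_def i_def k_def left_diff_distrib right_diff_distrib
        mult_assoc_eq[OF qp] mult_assoc_eq[OF q(2)] mult_assoc_eq[OF qn] q(2) qp qn mult.assoc)
  have pi: "p * i = 0" and pk: "p * k = 0"
    using p(1) by (simp_all add: i_def k_def left_diff_distrib right_diff_distrib mult.assoc
        mult_assoc_eq[OF p(1)])
  have p'i: "p' * i = 0" and p'k: "p' * k = 0"
    using pi pk qi qk by (simp_all add: p'_def left_diff_distrib right_diff_distrib mult.assoc)
  have p'p': "p' * p' = p'"
    using mult_assoc_eq[OF p'p, of "1 - q"] by (simp flip: p'_def)
  have fi: "f * i = i" and fp': "f * p' = p'"
    by (simp_all add: p'_def i_def left_diff_distrib right_diff_distrib mult.assoc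
        mult_assoc_eq[OF fp] mult_assoc_eq[OF fa] fp)
  have ap': "a * p' = 0" and ak: "a * k = 0"
    by (simp_all add: p'_def k_def left_diff_distrib right_diff_distrib mult.assoc
        mult_assoc_eq[OF p(2)] mult_assoc_eq[OF sk(2)] p(2) sk(2))
  have "k + i = (1 - p) * (a * s + n) * (1 - q)" by (simp add: i_def k_def algebra_simps)
  also have "\<dots> = (1 - p) * (1 - q)"
    unfolding sk(1)[symmetric] using q(1) by (simp add: algebra_simps)
  finally have one: "p' + k + i + q = 1" by (simp add: p'_def algebra_simps)
  have split: "p' * x + k * x + i * x + q * x = x" for x
    using one by (metis distrib_right mult_1)
  have split': "x * p' + x * k + x * i + x * q = x" for x
    using one by (metis distrib_left mult_1_right)
  have ki_p': "k * p' + i * p' = 0" using split[of p'] p'p' qp' by simp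
  have "i * p' = 0"
  proof (rule zero)
    have "a * (k * p' + i * p') = 0" using ki_p' by simp
    then show "a * (i * p') = 0" by (simp add: distrib_left mult_assoc_eq[OF ak])
  qed (simp_all add: mult_assoc_eq[OF fi] mult_assoc_eq[OF pi])
  then have ip': "i * p' = 0" and kp': "k * p' = 0" using ki_p' by simp_all
  have ki_i: "k * i + i * i = i" using split[of i] p'i qi by simp
  have ki: "k * i = 0"
  proof (rule zero)
    have eq: "k * i = i - i * i" using ki_i by (simp add: algebra_simps)
    show "f * (k * i) = k * i"
      unfolding eq by (simp add: right_diff_distrib mult_assoc_eq[OF fi] fi)
  qed (simp_all add: mult_assoc_eq[OF ak] mult_assoc_eq[OF pk])
  have ki_k: "k * k + i * k = k" using split[of k] p'k qk by simp
  have ik: "i * k = 0"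
  proof (rule zero)
    have "a * (k * k + i * k) = a * k" unfolding ki_k ..
    then show "a * (i * k) = 0" using ak by (simp add: distrib_left mult_assoc_eq[OF ak])
  qed (simp_all add: mult_assoc_eq[OF fi] mult_assoc_eq[OF pi])
  have ker: "(p' + k) * x = x" if "a * x = 0" for x
  proof -
    have qx: "q * x = 0" by (rule q(3)[OF that])
    have "i * x = 0"
    proof (rule zero)
      have "a * (p' * x + k * x + i * x + q * x) = 0" unfolding split by (fact that)
      then show "a * (i * x) = 0"
        using qx by (simp add: distrib_left mult_assoc_eq[OF ak] mult_assoc_eq[OF ap'])
    qed (simp_all add: mult_assoc_eq[OF fi] mult_assoc_eq[OF pi])
    then show ?thesis using split[of x] qx by (simp add: distrib_right)
  qed
  have "k * a = 0"
  proof (rule zero)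
    have eq: "k * a = a - p' * a - i * a" using split[of a] q(2) by (simp add: algebra_simps)
    show "f * (k * a) = k * a"
      unfolding eq by (simp add: right_diff_distrib mult_assoc_eq[OF fi] mult_assoc_eq[OF fp'] fa)
  qed (simp_all add: mult_assoc_eq[OF ak] mult_assoc_eq[OF pk])
  then have ran: "(p' + i) * a = a" using split[of a] q(2) by (simp add: distrib_right)
  have "p' + i = a * (b * (p' + i))"
    using fi fp' by (simp add: f_def distrib_left mult.assoc)
  then have prin: "p' + i \<in> rprinc a" unfolding rprinc_def by blast
  show thesis
    by (rule that[OF p'p pp' p'p' _ _ one p'k p'i p'q kp' ki kq ip' ik iq qp' qk qi ap' ak ker ran prin])
      (use ki_k ik ki_i ki in simp_all)
qed

text \<open>Left multiplication by u is the isomorphism from pR to qR, with inverse v. Injectivity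
  of a - e rests on v u = p, surjectivity on u v = q.\<close>

lemma special_clean_of_decomposition:
  fixes a p k i q u v :: "'a::ring_1"
  assumes idem: "p * p = p" "k * k = k" "i * i = i" "q * q = q"
    and one: "p + k + i + q = 1"
    and orth: "p * k = 0" "p * i = 0" "p * q = 0" "k * p = 0" "k * i = 0" "k * q = 0"
      "i * p = 0" "i * k = 0" "i * q = 0" "q * p = 0" "q * k = 0" "q * i = 0"
    and ker: "a * p = 0" "a * k = 0" "\<And>x. a * x = 0 \<Longrightarrow> (p + k) * x = x"
    and ran: "(p + i) * a = a" "p + i \<in> rprinc a"
    and uv: "u * v = q" "v * u = p" "q * u = u" "u * p = u" "p * v = v"
  shows "\<exists>e. e * e = e \<and> is_unit (a - e) \<and> rprinc a \<inter> rprinc e = {0}"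
proof -
  have kill: "x * t = 0" if "x * y = 0" and "y * t = t" for x y t :: 'a
    using mult_assoc_eq[OF that(1), of t] that(2) by simp
  have kill': "t * y = 0" if "t * x = t" and "x * y = 0" for t x y :: 'a
    using mult_assoc_eq[OF that(1), of y] that(2) by simp
  have ku: "k * u = 0" by (rule kill[OF orth(6) uv(3)])
  have uk: "u * k = 0" by (rule kill'[OF uv(4) orth(1)])
  have uq: "u * q = 0" by (rule kill'[OF uv(4) orth(3)])
  have uu: "u * u = 0" by (rule kill[OF uq uv(3)])
  have kv: "k * v = 0" by (rule kill[OF orth(4) uv(5)])
  have qv: "q * v = 0" by (rule kill[OF orth(10) uv(5)])
  have av: "a * v = 0" by (rule kill[OF ker(1) uv(5)])
  have ka: "k * a = 0" by (rule kill[OF _ ran(1)]) (simp add: distrib_left orth)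
  have qa: "q * a = 0" by (rule kill[OF _ ran(1)]) (simp add: distrib_left orth)
  \<comment> \<open>e has to fix kR and qR and to kill both iR and every x + u x with x in pR; so it
    sends such an x to - u x.\<close>
  define e where "e = k + q - u"
  have ke: "k * e = k" and qe: "q * e = q - u" and ue: "u * e = 0"
    by (simp_all add: e_def distrib_left right_diff_distrib idem orth ku uv(3) uk uq uu)
  have ek: "e * k = k" and ev: "e * v = - q"
    by (simp_all add: e_def distrib_right left_diff_distrib idem orth uk kv qv uv(1))
  have "e * e = k * e + q * e - u * e"
    by (subst (1) e_def) (simp only: distrib_right left_diff_distrib)
  then have e: "e * e = e" by (simp add: ke qe ue) (simp add: e_def)
  have ex: "e * x = k * x + q * x - u * x" for x
    by (simp add: e_def distrib_right left_diff_distrib)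
  \<comment> \<open>On aR both k and q vanish, so x = e x = - u x. This lies in qR, which q fixes,
    while q x = 0.\<close>
  have int: "x = 0" if "x = a * y" and "x = e * z" for x y z
  proof -
    have kx: "k * x = 0" and qx: "q * x = 0"
      by (simp_all add: that(1) mult_assoc_eq[OF ka] mult_assoc_eq[OF qa])
    have "e * x = x" by (simp add: that(2) mult_assoc_eq[OF e])
    then have xu: "x = - (u * x)" using ex[of x] kx qx by simp
    then have "q * x = - (q * (u * x))" by (metis mult_minus_right)
    then have "u * x = 0" using qx by (simp add: mult_assoc_eq[OF uv(3)])
    then show "x = 0" using xu by simp
  qed
  \<comment> \<open>a x = e x lies in aR \<inter> eR, hence is 0. Then x is in r(a) and is killed by
    e, which forces first its k part and then u x to vanish.\<close>
  have inj: "x = 0" if "(a - e) * x = 0" for x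
  proof -
    have ax: "a * x = e * x" using that by (simp add: left_diff_distrib)
    have a0: "a * x = 0" using int[of "a * x" x x] ax by simp
    then have pk: "(p + k) * x = x" by (rule ker(3))
    have "k * (e * x) = 0" using ax a0 by simp
    then have kx: "k * x = 0" by (simp add: mult_assoc_eq[OF ke])
    then have px: "p * x = x" using pk by (simp add: distrib_right)
    have qx: "q * x = 0" by (rule kill[OF orth(10) px])
    have "u * x = 0" using ax a0 kx qx ex[of x] by simp
    then have "v * (u * x) = 0" by simp
    then show "x = 0" using px by (simp add: mult_assoc_eq[OF uv(2)])
  qed
  obtain b where b: "p + i = a * b" using ran(2) by (auto simp: rprinc_def)
  have kq: "(a - e) * (v - k) = k + q"
    by (simp add: left_diff_distrib right_diff_distrib av ev ek ker(2))
  have kqe: "(k + q) * (e * b) = e * b"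
  proof -
    have "(k + q) * e = e" by (simp add: distrib_right ke qe) (simp add: e_def)
    then show ?thesis by (rule mult_assoc_eq)
  qed
  \<comment> \<open>(a - e) b = (p + i) - e b, and e b lies in (k + q)R. The second summand of r
    contributes k + q + e b, which cancels the error and completes the sum to 1.\<close>
  define r where "r = b + (v - k) * (1 + e * b)"
  have "(a - e) * r = (a - e) * b + (k + q) * (1 + e * b)"
    by (simp only: r_def distrib_left[of "a - e"] mult_assoc_eq[OF kq])
  also have "\<dots> = a * b + (k + q)"
    by (simp add: left_diff_distrib distrib_left kqe)
  also have "\<dots> = 1" using b[symmetric] one by (simp add: ac_simps)
  finally have r: "(a - e) * r = 1" .
  have "(a - e) * (r * (a - e) - 1) = 0"
    by (simp add: right_diff_distrib[of "a - e"] mult_assoc_eq[OF r])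
  then have "r * (a - e) - 1 = 0" by (rule inj)
  then have "is_unit (a - e)" unfolding is_unit_def using r by (intro exI[of _ r]) simp
  moreover have "rprinc a \<inter> rprinc e = {0}"
  proof
    show "rprinc a \<inter> rprinc e \<subseteq> {0}" using int unfolding rprinc_def by blast
    have "a * 0 = 0" and "e * 0 = 0" by simp_all
    then show "{0} \<subseteq> rprinc a \<inter> rprinc e" unfolding rprinc_def by (auto intro: exI[of _ 0])
  qed
  ultimately show ?thesis using e by blast
qed

theorem theorem3p4:
  fixes a :: "'a::ring_1"
  assumes "exchange_ring TYPE('a)"
    and "separative TYPE('a)"
    and "is_unit (2::'a)"
    and "regular (a - a ^ 3)"
    and "projective (quot_mod (rprinc a) {a * y | y. y \<in> rann (a ^ 2)})"
    and "projective (quot_mod UNIV (set_plus (rprinc a) (rann a)))"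
    and "ideal_gen {a * y | y. y \<in> rann (a ^ 2)} = ideal_gen {l * a | l. l \<in> lann (a ^ 2)}"
    and "ideal_gen {l * a | l. l \<in> lann (a ^ 2)} = ideal_gen {a - a ^ 3}"
  shows "\<exists>e::'a. e * e = e \<and> is_unit (a - e) \<and> rprinc a \<inter> rprinc e = {0}"
proof -
  define d where "d = a - a * a * a"
  have cube: "a - a ^ 3 = d" by (simp add: d_def power3_eq_cube)
  obtain y where y: "d * y * d = d" using assms(4) unfolding regular_def cube by metis
  \<comment> \<open>As d = a (1 - a^2) = (1 - a^2) a, an inner inverse y of d gives one of a: a b a
    = a^3 + d y d.\<close>
  define b where "b = a + (1 - a * a) * y * (1 - a * a)"
  have "a * b * a = a * a * a + d * y * d" by (simp add: b_def d_def algebra_simps)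
  then have b: "a * b * a = a" unfolding y by (simp add: d_def)
  let ?K = "set_plus (rprinc a) (rann a)"
  have K: "x \<in> ?K \<longleftrightarrow> (\<exists>s n. x = a * s + n \<and> a * n = 0)" for x
    by (auto simp: set_plus_def rprinc_def rann_def)
  have K0: "0 \<in> ?K" unfolding K by (intro exI[of _ 0]) simp
  have Kadd: "x + z \<in> ?K" if xz: "x \<in> ?K" "z \<in> ?K" for x z
  proof -
    obtain s n s' n' where "x = a * s + n" "a * n = 0" "z = a * s' + n'" "a * n' = 0"
      using xz unfolding K by blast
    then show ?thesis
      unfolding K by (intro exI[of _ "s + s'"] exI[of _ "n + n'"]) (simp add: algebra_simps)
  qed
  have Kmul: "x * r \<in> ?K" if x: "x \<in> ?K" for x r
  proof -
    obtain s n where "x = a * s + n" and an: "a * n = 0" using x unfolding K by blast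
    then show ?thesis
      unfolding K by (intro exI[of _ "s * r"] exI[of _ "n * r"])
        (simp add: distrib_right mult.assoc mult_assoc_eq[OF an])
  qed
  obtain q where q: "q * q = q" "1 - q \<in> ?K" "\<And>x. x \<in> ?K \<Longrightarrow> q * x = 0"
    using projective_quotient_split[OF assms(6) K0 Kadd Kmul] by blast
  have qa: "q * a = 0" by (rule q(3)) (unfold K, intro exI[of _ 1] exI[of _ 0], simp)
  have qker: "q * x = 0" if "a * x = 0" for x
    by (rule q(3)) (unfold K, intro exI[of _ 0] exI[of _ x], simp add: that)
  obtain s n where sk: "1 - q = a * s + n" "a * n = 0" using q(2) unfolding K by blast
  obtain p c where p: "p * p = p" "a * p = 0" "p \<in> rprinc a"
    "\<And>x. x \<in> rprinc a \<Longrightarrow> a * x = 0 \<Longrightarrow> p * x = x"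
    and pc: "idem_class (d * y) = idem_class p + c" and qc: "idem_class (d * y) = idem_class q + c"
    using kernel_cokernel_classes[OF d_def y q(1) qa qker sk] by blast
  have w: "d * y * (d * y) = d * y" using mult_assoc_eq[OF y] by simp
  have "d \<in> ideal_gen {d}"
    unfolding ideal_gen_def
    by (rule CollectI, intro exI[of _ 1] exI[of _ "\<lambda>_. 1"] exI[of _ "\<lambda>_. d"]) simp
  then have dp: "d \<in> ideal_gen {a * y | y. y \<in> rann (a ^ 2)}"
    and dq: "d \<in> ideal_gen {l * a | l. l \<in> lann (a ^ 2)}"
    using assms(7,8) unfolding cube by simp_all
  \<comment> \<open>A generator a y with a^2 y = 0 lies in aR \<inter> r(a), which p fixes.\<close>
  have "\<exists>u v. x = u * p * v" if "x \<in> {a * y | y. y \<in> rann (a ^ 2)}" for x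
  proof -
    have "x \<in> rprinc a" "a * x = 0"
      using that by (auto simp: rprinc_def rann_def power2_eq_square mult.assoc)
    then have "x = 1 * p * x" using p(4) by simp
    then show ?thesis by blast
  qed
  then obtain m c1 where m: "mult_of m (idem_class p) = idem_class (d * y) + c1"
    using idem_class_le_ideal[OF p(1) w refl dp] by blast
  \<comment> \<open>Dually, l a with l a^2 = 0 annihilates aR as well as r(a), hence 1 - q; so x = x
    q.\<close>
  have "\<exists>u v. x = u * q * v" if "x \<in> {l * a | l. l \<in> lann (a ^ 2)}" for x
  proof -
    obtain l where l: "x = l * a" "l * (a * a) = 0"
      using \<open>x \<in> {l * a | l. l \<in> lann (a ^ 2)}\<close> by (auto simp: lann_def power2_eq_square)
    have xa: "x * a = 0" and xn: "x * n = 0" using l sk(2) by (simp_all add: mult.assoc)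
    have "x * (1 - q) = 0" by (simp add: sk(1) distrib_left mult_assoc_eq[OF xa] xn)
    then have "x = x * q * 1" by (simp add: right_diff_distrib)
    then show ?thesis by blast
  qed
  then obtain m' c2 where m': "mult_of m' (idem_class q) = idem_class (d * y) + c2"
    using idem_class_le_ideal[OF q(1) w refl dq] by blast
  have "idem_class p = idem_class q"
  proof (rule separative_cancel)
    show "idem_class p + c = idem_class q + c" using pc qc by simp
    show "mult_of m (idem_class p) = c + (idem_class p + c1)" using m pc by (simp add: ac_simps)
    show "mult_of m' (idem_class q) = c + (idem_class q + c2)" using m' qc by (simp add: ac_simps)
  qed (rule separative_proj_class[OF assms(2)])
  then obtain u v where uv: "u * v = q" "v * u = p" "q * u = u" "u * p = u" "p * v = v"
    using idem_class_eqE[OF p(1) q(1)] by metis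
  obtain p' k i where pp: "p' * p = p" "p * p' = p'"
    and idem: "p' * p' = p'" "k * k = k" "i * i = i" and one: "p' + k + i + q = 1"
    and orth: "p' * k = 0" "p' * i = 0" "p' * q = 0" "k * p' = 0" "k * i = 0" "k * q = 0"
      "i * p' = 0" "i * k = 0" "i * q = 0" "q * p' = 0" "q * k = 0" "q * i = 0"
    and ker: "a * p' = 0" "a * k = 0" "\<And>x. a * x = 0 \<Longrightarrow> (p' + k) * x = x"
    and ran: "(p' + i) * a = a" "p' + i \<in> rprinc a"
    by (rule kernel_range_decomposition[OF b p q(1) qa qker sk])
      (assumption | (rule that; assumption))+
  \<comment> \<open>Since pR = p'R, the inverse v already maps qR into p'R and stays; only u has to
    be cut down by p' on the right.\<close>
  have uv': "u * p' * v = q" "v * (u * p') = p'" "q * (u * p') = u * p'"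
    "u * p' * p' = u * p'" "p' * v = v"
    using mult_assoc_eq[OF pp(1), of v] uv pp(2) idem(1)
    by (simp_all add: mult.assoc mult_assoc_eq[OF uv(2)] mult_assoc_eq[OF uv(3)])
  show ?thesis
    by (rule special_clean_of_decomposition[OF idem q(1) one orth ker ran uv'])
qed

end
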